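(* Let $3\le n\le 9$. There are infinitely many integers $k>2$ for each of which the open interval $$Z(k):=\left(\frac{k(n-1)}{\pi},\ (k^2-2)\sqrt{\frac{n-2}{k^2-1}}\right)$$ is nonempty and such that, for every $h\in Z(k)$, the equation $W(h,C)=\frac{2\pi}{k}$ is solvable for some $C\in(0,C_h)$; consequently the complete curve $\gamma_{h,C}$ generates an embedded Delaunay hypersurface of constant mean curvature $h$ in $\mathbb S^n$ consisting of $k$ periods of oscillation.
   Context: $\mathbb S^n$ is the unit sphere of $\mathbb C\oplus\mathbb R^{n-1}$, $\mathbb S^2$ the unit sphere of $\mathbb C\oplus\mathbb R$, $S^{n-2}$ the unit sphere of $\mathbb R^{n-1}$. A curve $\gamma=(z,b)$ in $\mathbb S^2$ with $b>0$ generates the hypersurface $G_\gamma(t,x)=(z(t),b(t)x)$, $x\in S^{n-2}$, in $\mathbb S^n$. Mean curvature is unnormalized (trace of the second fundamental form) with respect to the normal pointing toward the great circle $\{b=0\}$, sign such that thin tubes around this great circle have positive mean curvature. For $h>0$ put $L(s)=\cos s\,\sin^{n-2}s$, $R(s,C,h)=C+\frac{h}{n-1}\sin^{n-1}s$; let $s_h\in(0,\frac{\pi}{2})$ be the unique solution of $-\tan s_h+(n-2)\cot s_h=h$ and $C_h:=L(s_h)-\frac{h}{n-1}\sin^{n-1}s_h>0$. For $C\in(0,C_h)$ the set $\{s\in(0,\frac{\pi}{2}):R(s,C,h)<L(s)\}$ is an interval $(z_L,z_R)$ with $0<z_L<z_R<\frac{\pi}{2}$. Let $s_1(s)=\int_{z_L}^{s}\frac{R}{\cos\sigma\sqrt{L^2-R^2}}\,d\sigma$,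 $T=s_1(z_R)<\infty$, and $W(h,C):=2T$. Let $s=\rho(t)$, $t\in[0,T]$, be the inverse function of $s_1$, extended to $\mathbb R$ as an even $2T$-periodic function. Then $\gamma_{h,C}(t)=(\cos\rho(t)\,e^{it},\sin\rho(t))$, $t\in\mathbb R$. *)

theory Defs
  imports "HOL-Analysis.Analysis"
begin

section \<open>Smooth maps, immersions and mean curvature\<close>

primrec C_k :: "nat \<Rightarrow> ('a::real_normed_vector \<Rightarrow> 'b::real_normed_vector) \<Rightarrow> bool" where
  "C_k 0 f \<longleftrightarrow> continuous_on UNIV f"
| "C_k (Suc k) f \<longleftrightarrow> (\<forall>x. f differentiable (at x)) \<and>
     (\<forall>v. C_k k (\<lambda>x. frechet_derivative f (at x) v))"

definition smooth :: "('a::real_normed_vector \<Rightarrow> 'b::real_normed_vector) \<Rightarrow> bool" where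
  "smooth f \<longleftrightarrow> (\<forall>k. C_k k f)"

text \<open>
  The parameter manifold is \<open>\<real> \<times> S\<close>, with \<open>S\<close> the unit sphere of \<open>'a\<close>, where \<open>DIM('a) = n - 1\<close>.
  Smooth maps on it are represented by smooth extensions to \<open>\<real> \<times> 'a\<close>; immersions, normals and
  curvature only involve the values on \<open>\<real> \<times> S\<close> and the derivatives along its tangent spaces.
  The target is the unit sphere of \<open>complex \<times> 'a\<close>.
\<close>

definition cylinder :: "(real \<times> 'a::euclidean_space) set" where
  "cylinder = UNIV \<times> sphere 0 1"

definition cylinder_tangent :: "real \<times> 'a::euclidean_space \<Rightarrow> (real \<times> 'a) set" where
  "cylinder_tangent p = {v. snd v \<bullet> snd p = 0}"

definition smooth_immersion :: "(real \<times> 'a::euclidean_space \<Rightarrow> complex \<times> 'a) \<Rightarrow> bool" where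
  "smooth_immersion G \<longleftrightarrow> smooth G \<and>
     (\<forall>p\<in>cylinder. G p \<in> sphere 0 1 \<and>
        inj_on (frechet_derivative G (at p)) (cylinder_tangent p))"

text \<open>
  \<open>G\<close> descends to an injective immersion of the compact manifold \<open>(\<real> / \<tau>\<int>) \<times> S\<close>, that is,
  to an embedding of it.
\<close>

definition embedded_with_period ::
    "(real \<times> 'a::euclidean_space \<Rightarrow> complex \<times> 'a) \<Rightarrow> real \<Rightarrow> bool" where
  "embedded_with_period G \<tau> \<longleftrightarrow> smooth_immersion G \<and> 0 < \<tau> \<and>
     (\<forall>t t'. \<forall>x\<in>sphere 0 1. \<forall>x'\<in>sphere 0 1.
        G (t, x) = G (t', x') \<longleftrightarrow> x = x' \<and> (\<exists>m::int. t' = t + of_int m * \<tau>))"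

text \<open>Unit normal fields of \<open>G\<close> within the sphere: orthogonal also to the position vector.\<close>

definition unit_normal_field ::
    "(real \<times> 'a::euclidean_space \<Rightarrow> complex \<times> 'a) \<Rightarrow> (real \<times> 'a \<Rightarrow> complex \<times> 'a) \<Rightarrow> bool" where
  "unit_normal_field G N \<longleftrightarrow> smooth N \<and>
     (\<forall>p\<in>cylinder. norm (N p) = 1 \<and> N p \<bullet> G p = 0 \<and>
        (\<forall>v\<in>cylinder_tangent p. N p \<bullet> frechet_derivative G (at p) v = 0))"

text \<open>
  By the Weingarten equation this is the normal component of the second derivative of \<open>G\<close>
  in the direction of \<open>N\<close>; it is positive on small spheres when \<open>N\<close> points inwards.
\<close>

definition second_fundamental_form ::
    "(real \<times> 'a::euclidean_space \<Rightarrow> complex \<times> 'a) \<Rightarrow> (real \<times> 'a \<Rightarrow> complex \<times> 'a) \<Rightarrow>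
     real \<times> 'a \<Rightarrow> real \<times> 'a \<Rightarrow> real \<times> 'a \<Rightarrow> real" where
  "second_fundamental_form G N p v w =
     - (frechet_derivative N (at p) v \<bullet> frechet_derivative G (at p) w)"

text \<open>Bases of the tangent space that are orthonormal for the metric induced by \<open>G\<close>.\<close>

definition orthonormal_frame ::
    "(real \<times> 'a::euclidean_space \<Rightarrow> complex \<times> 'a) \<Rightarrow> real \<times> 'a \<Rightarrow> (real \<times> 'a) set \<Rightarrow> bool" where
  "orthonormal_frame G p B \<longleftrightarrow> span B = cylinder_tangent p \<and>
     (\<forall>v\<in>B. \<forall>w\<in>B. frechet_derivative G (at p) v \<bullet> frechet_derivative G (at p) w =
        (if v = w then 1 else 0))"

text \<open>The unnormalized trace; it does not depend on the frame.\<close>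

definition mean_curvature ::
    "(real \<times> 'a::euclidean_space \<Rightarrow> complex \<times> 'a) \<Rightarrow> (real \<times> 'a \<Rightarrow> complex \<times> 'a) \<Rightarrow>
     real \<times> 'a \<Rightarrow> real" where
  "mean_curvature G N p =
     (\<Sum>v\<in>(SOME B. orthonormal_frame G p B). second_fundamental_form G N p v v)"

text \<open>
  The distance from a point \<open>(z, y)\<close> of the sphere to the great circle \<open>y = 0\<close> increases with
  \<open>norm y\<close>, whose derivative in the direction \<open>N\<close> is \<open>(snd N \<bullet> y) / norm y\<close>; so the sign condition
  says that \<open>N\<close> points toward this circle.
\<close>

definition has_constant_mean_curvature ::
    "(real \<times> 'a::euclidean_space \<Rightarrow> complex \<times> 'a) \<Rightarrow> real \<Rightarrow> bool" where
  "has_constant_mean_curvature G h \<longleftrightarrow>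
     (\<exists>N. unit_normal_field G N \<and>
        (\<forall>p\<in>cylinder. snd (N p) \<bullet> snd (G p) < 0 \<and> mean_curvature G N p = h))"

definition least_period :: "(real \<Rightarrow> 'b) \<Rightarrow> real \<Rightarrow> bool" where
  "least_period f p \<longleftrightarrow> 0 < p \<and> (\<forall>t. f (t + p) = f t) \<and>
     (\<forall>q. 0 < q \<and> (\<forall>t. f (t + q) = f t) \<longrightarrow> p \<le> q)"

section \<open>Rotational hypersurfaces and Delaunay curves\<close>

definition profile_curve :: "(real \<Rightarrow> complex \<times> real) \<Rightarrow> bool" where
  "profile_curve \<gamma> \<longleftrightarrow> (\<forall>t. \<gamma> t \<in> sphere 0 1 \<and> 0 < snd (\<gamma> t))"

definition rot_hypersurface ::
    "(real \<Rightarrow> complex \<times> real) \<Rightarrow> real \<times> 'a::euclidean_space \<Rightarrow> complex \<times> 'a" where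
  "rot_hypersurface \<gamma> = (\<lambda>(t, x). (fst (\<gamma> t), snd (\<gamma> t) *\<^sub>R x))"

definition L_fun :: "nat \<Rightarrow> real \<Rightarrow> real" where
  "L_fun n s = cos s * sin s ^ (n - 2)"

definition R_fun :: "nat \<Rightarrow> real \<Rightarrow> real \<Rightarrow> real \<Rightarrow> real" where
  "R_fun n h C s = C + h / (real n - 1) * sin s ^ (n - 1)"

definition s_crit :: "nat \<Rightarrow> real \<Rightarrow> real" where
  "s_crit n h = (THE s. s \<in> {0<..<pi/2} \<and> - tan s + (real n - 2) * cot s = h)"

definition C_crit :: "nat \<Rightarrow> real \<Rightarrow> real" where
  "C_crit n h = L_fun n (s_crit n h) - h / (real n - 1) * sin (s_crit n h) ^ (n - 1)"

definition z_L :: "nat \<Rightarrow> real \<Rightarrow> real \<Rightarrow> real" where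
  "z_L n h C = Inf {s \<in> {0<..<pi/2}. R_fun n h C s < L_fun n s}"

definition z_R :: "nat \<Rightarrow> real \<Rightarrow> real \<Rightarrow> real" where
  "z_R n h C = Sup {s \<in> {0<..<pi/2}. R_fun n h C s < L_fun n s}"

text \<open>The integrand is singular at \<open>z_L\<close> and \<open>z_R\<close>; its values there are irrelevant.\<close>

definition s_1 :: "nat \<Rightarrow> real \<Rightarrow> real \<Rightarrow> real \<Rightarrow> real" where
  "s_1 n h C s = integral {z_L n h C..s}
     (\<lambda>\<sigma>. R_fun n h C \<sigma> / (cos \<sigma> * sqrt ((L_fun n \<sigma>)\<^sup>2 - (R_fun n h C \<sigma>)\<^sup>2)))"

definition half_period :: "nat \<Rightarrow> real \<Rightarrow> real \<Rightarrow> real" where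
  "half_period n h C = s_1 n h C (z_R n h C)"

definition W :: "nat \<Rightarrow> real \<Rightarrow> real \<Rightarrow> real" where
  "W n h C = 2 * half_period n h C"

text \<open>
  The even \<open>W\<close>-periodic extension from \<open>[0, W/2]\<close> of the inverse function of \<open>s_1\<close>: the argument
  of the inverse is the distance from \<open>t\<close> to the nearest integer multiple of \<open>W\<close>.
\<close>

definition \<rho> :: "nat \<Rightarrow> real \<Rightarrow> real \<Rightarrow> real \<Rightarrow> real" where
  "\<rho> n h C t = the_inv_into {z_L n h C..z_R n h C} (s_1 n h C)
     \<bar>t - W n h C * of_int (round (t / W n h C))\<bar>"

definition delaunay_curve :: "nat \<Rightarrow> real \<Rightarrow> real \<Rightarrow> real \<Rightarrow> complex \<times> real" where
  "delaunay_curve n h C t = (of_real (cos (\<rho> n h C t)) * cis t, sin (\<rho> n h C t))"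

definition Z :: "nat \<Rightarrow> nat \<Rightarrow> real set" where
  "Z n k = {real k * (real n - 1) / pi <..<
            ((real k)\<^sup>2 - 2) * sqrt ((real n - 2) / ((real k)\<^sup>2 - 1))}"

end

theory Submission
  imports Defs
begin

text \<open>
  The function \<open>g = L - h / (n - 1) sin\<^sup>n\<^sup>-\<^sup>1\<close> increases up to \<open>s\<^sub>h\<close> and decreases afterwards, and \<open>z\<^sub>L\<close>, \<open>z\<^sub>R\<close> are
  the two solutions of \<open>g = C\<close>. Dividing \<open>g - C\<close> by \<open>(s - z\<^sub>L) (z\<^sub>R - s)\<close> gives a divided difference
  of \<open>g\<close>, which is jointly continuous and positive up to the degenerate case \<open>C = C\<^sub>h\<close>. The
  substitution \<open>s = (z\<^sub>L + z\<^sub>R) / 2 + (z\<^sub>R - z\<^sub>L) / 2 sin \<phi>\<close> therefore turns the integral for \<open>s\<^sub>1\<close> into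
  one with a continuous positive integrand on the whole line: its inverse produces the even periodic
  extension \<open>\<rho>\<close> at once, and the half period \<open>T\<close> extends continuously to \<open>C = C\<^sub>h\<close> with value
  \<open>\<pi> / sqrt (1 + (n - 2) cot\<^sup>2 s\<^sub>h)\<close>, which exceeds \<open>\<pi> / k\<close> exactly under the upper bound on \<open>h\<close>.
  For small \<open>C\<close> the half period is at most \<open>(n - 1) / h\<close> up to an arbitrarily small error, which is below
  \<open>\<pi> / k\<close> by the lower bound on \<open>h\<close>; the intermediate value theorem gives \<open>C\<close>.

  The function \<open>\<rho>\<close> satisfies \<open>\<rho>'\<^sup>2 = F(\<rho>)\<close> and \<open>\<rho>'' = F'(\<rho>) / 2\<close> with \<open>F = cos\<^sup>2 (L\<^sup>2 / R\<^sup>2 - 1)\<close>. Hence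
  all functions in question lie in an algebra closed under differentiation, so they are smooth,
  and the second equation says that the mean curvature is \<open>h\<close>.
\<close>

section \<open>Smoothness from algebras closed under derivatives\<close>

text \<open>The induction on the order runs over all members of \<open>S\<close> at once, since the
  step replaces a function by a directional derivative, which is again a member.\<close>

lemma smooth_coinduct:
  assumes "S f"
    and step: "\<And>f x. S f \<Longrightarrow> f differentiable (at x)"
      "\<And>f v. S f \<Longrightarrow> S (\<lambda>x. frechet_derivative f (at x) v)"
  shows "smooth f"
proof -
  have "C_k k f" if "S f" for k f
    using that
  proof (induction k arbitrary: f)
    case 0
    then show ?case
      using step(1) by (auto simp: continuous_on_eq_continuous_at intro: differentiable_imp_continuous_within)
  next
    case (Suc k)
    then show ?case using step by auto
  qed
  then show ?thesis using assms(1) by (auto simp: smooth_def)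
qed

text \<open>The subalgebra generated by \<open>\<Gamma>\<close>. It offers no division, so
  reciprocals have to be put among the generators.\<close>

inductive fun_alg :: "('a \<Rightarrow> real) set \<Rightarrow> ('a \<Rightarrow> real) \<Rightarrow> bool" for \<Gamma> where
  gen: "f \<in> \<Gamma> \<Longrightarrow> fun_alg \<Gamma> f"
| const: "fun_alg \<Gamma> (\<lambda>_. c)"
| add: "fun_alg \<Gamma> f \<Longrightarrow> fun_alg \<Gamma> g \<Longrightarrow> fun_alg \<Gamma> (\<lambda>x. f x + g x)"
| mult: "fun_alg \<Gamma> f \<Longrightarrow> fun_alg \<Gamma> g \<Longrightarrow> fun_alg \<Gamma> (\<lambda>x. f x * g x)"

lemma fun_alg_minus: "fun_alg \<Gamma> f \<Longrightarrow> fun_alg \<Gamma> (\<lambda>x. - f x)"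
  using fun_alg.mult[OF fun_alg.const[of _ "-1"], of \<Gamma> f] by simp

lemma fun_alg_diff: "fun_alg \<Gamma> f \<Longrightarrow> fun_alg \<Gamma> g \<Longrightarrow> fun_alg \<Gamma> (\<lambda>x. f x - g x)"
  using fun_alg.add[OF _ fun_alg_minus, of \<Gamma> f g] by simp

lemma fun_alg_power: "fun_alg \<Gamma> f \<Longrightarrow> fun_alg \<Gamma> (\<lambda>x. f x ^ k)"
  by (induction k) (auto intro: fun_alg.intros)

lemmas fun_alg_intros = fun_alg.const fun_alg.add fun_alg.mult fun_alg_minus fun_alg_diff
  fun_alg_power

text \<open>Sum and product rule: if the directional derivatives of the generators are polynomials
  in the generators, the whole algebra is closed under differentiation.\<close>

lemma fun_alg_derivative:
  fixes \<Gamma> :: "('a::real_normed_vector \<Rightarrow> real) set"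
  assumes gen: "\<And>f. f \<in> \<Gamma> \<Longrightarrow>
      \<exists>f'. (\<forall>x. (f has_derivative f' x) (at x)) \<and> (\<forall>v. fun_alg \<Gamma> (\<lambda>x. f' x v))"
    and "fun_alg \<Gamma> f"
  shows "\<exists>f'. (\<forall>x. (f has_derivative f' x) (at x)) \<and> (\<forall>v. fun_alg \<Gamma> (\<lambda>x. f' x v))"
  using assms(2)
proof induction
  case (gen f)
  then show ?case using assms(1) by blast
next
  case (const c)
  then show ?case by (intro exI[of _ "\<lambda>_ _. 0"]) (auto intro: fun_alg.intros)
next
  case (add f g)
  then obtain f' g' where
    "\<And>x. (f has_derivative f' x) (at x)" "\<And>v. fun_alg \<Gamma> (\<lambda>x. f' x v)"
    "\<And>x. (g has_derivative g' x) (at x)" "\<And>v. fun_alg \<Gamma> (\<lambda>x. g' x v)" by blast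
  then show ?case
    by (intro exI[of _ "\<lambda>x v. f' x v + g' x v"]) (auto intro: fun_alg.intros has_derivative_add)
next
  case (mult f g)
  then obtain f' g' where *:
    "\<And>x. (f has_derivative f' x) (at x)" "\<And>v. fun_alg \<Gamma> (\<lambda>x. f' x v)"
    "\<And>x. (g has_derivative g' x) (at x)" "\<And>v. fun_alg \<Gamma> (\<lambda>x. g' x v)" by blast
  show ?case
    by (intro exI[of _ "\<lambda>x v. f x * g' x v + f' x v * g x"] conjI allI has_derivative_mult *
      fun_alg.add[OF fun_alg.mult[OF mult.hyps(1) *(4)] fun_alg.mult[OF *(2) mult.hyps(2)]])
qed

text \<open>The maps all of whose coordinates lie in the algebra form a class to which
  \<open>smooth_coinduct\<close> applies; the derivative is assembled coordinate by
  coordinate.\<close>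

lemma smooth_fun_alg:
  fixes F :: "'a::real_normed_vector \<Rightarrow> 'b::euclidean_space"
  assumes gen: "\<And>f. f \<in> \<Gamma> \<Longrightarrow>
      \<exists>f'. (\<forall>x. (f has_derivative f' x) (at x)) \<and> (\<forall>v. fun_alg \<Gamma> (\<lambda>x. f' x v))"
    and F: "\<And>i. i \<in> Basis \<Longrightarrow> fun_alg \<Gamma> (\<lambda>x. F x \<bullet> i)"
  shows "smooth F"
proof (rule smooth_coinduct[where S = "\<lambda>F. \<forall>i\<in>Basis. fun_alg \<Gamma> (\<lambda>x. F x \<bullet> i)"])
  have *: "\<exists>F'. (\<forall>x. (f has_derivative F' x) (at x)) \<and> (\<forall>v. \<forall>i\<in>Basis. fun_alg \<Gamma> (\<lambda>x. F' x v \<bullet> i))"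
    if f: "\<forall>i\<in>Basis. fun_alg \<Gamma> (\<lambda>x. f x \<bullet> i)" for f :: "'a \<Rightarrow> 'b"
  proof -
    have "\<forall>i\<in>Basis. \<exists>f'. (\<forall>x. ((\<lambda>x. f x \<bullet> i) has_derivative f' x) (at x)) \<and>
        (\<forall>v. fun_alg \<Gamma> (\<lambda>x. f' x v))"
      using fun_alg_derivative[OF gen] f by blast
    from bchoice[OF this] obtain f' where f': "\<And>i x. i \<in> Basis \<Longrightarrow> ((\<lambda>x. f x \<bullet> i) has_derivative f' i x) (at x)"
      "\<And>i v. i \<in> Basis \<Longrightarrow> fun_alg \<Gamma> (\<lambda>x. f' i x v)" by blast
    show ?thesis
      by (rule exI[of _ "\<lambda>x v. \<Sum>i\<in>Basis. f' i x v *\<^sub>R i"])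
        (auto simp: has_derivative_componentwise_within[of f] f')
  qed
  fix f :: "'a \<Rightarrow> 'b" assume "\<forall>i\<in>Basis. fun_alg \<Gamma> (\<lambda>x. f x \<bullet> i)"
  from *[OF this] obtain F' where F': "\<And>x. (f has_derivative F' x) (at x)"
    "\<And>v. \<forall>i\<in>Basis. fun_alg \<Gamma> (\<lambda>x. F' x v \<bullet> i)" by blast
  show "f differentiable (at x)" for x
    using F'(1) by (auto simp: differentiable_def)
  have "frechet_derivative f (at x) = F' x" for x
    using frechet_derivative_at[OF F'(1)] by simp
  then show "\<forall>i\<in>Basis. fun_alg \<Gamma> (\<lambda>x. frechet_derivative f (at x) v \<bullet> i)" for v
    using F'(2) by simp
qed (use F in auto)

section \<open>Curvature of rotation hypersurfaces\<close>

lemma rot_has_derivative: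
  fixes x :: "'a::euclidean_space"
  assumes "(\<gamma> has_vector_derivative \<gamma>') (at t)"
  shows "(rot_hypersurface \<gamma> has_derivative
    (\<lambda>v. (fst v *\<^sub>R fst \<gamma>', (fst v * snd \<gamma>') *\<^sub>R x + snd (\<gamma> t) *\<^sub>R snd v))) (at (t, x))"
proof -
  have g: "((\<lambda>p. \<gamma> (fst p)) has_derivative (\<lambda>v. fst v *\<^sub>R \<gamma>')) (at (t, x))"
    using has_derivative_compose[of fst fst "(t,x)" UNIV \<gamma> "\<lambda>\<tau>. \<tau> *\<^sub>R \<gamma>'"] assms
      has_derivative_fst[OF has_derivative_ident, of "at (t, x)"]
    by (auto simp: has_vector_derivative_def)
  have "((\<lambda>p. (fst (\<gamma> (fst p)), snd (\<gamma> (fst p)) *\<^sub>R snd p)) has_derivative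
    (\<lambda>v. (fst (fst v *\<^sub>R \<gamma>'), snd (\<gamma> (fst (t, x))) *\<^sub>R snd v + snd (fst v *\<^sub>R \<gamma>') *\<^sub>R snd (t, x)))) (at (t, x))"
    by (intro has_derivative_Pair has_derivative_fst has_derivative_snd g has_derivative_scaleR has_derivative_ident)
  then show ?thesis
    by (simp add: rot_hypersurface_def case_prod_unfold add.commute)
qed

lemmas frechet_rot = frechet_derivative_at[OF rot_has_derivative, symmetric]

lemma dim_cylinder_tangent:
  fixes x :: "'a::euclidean_space"
  assumes "x \<in> sphere 0 1"
  shows "dim (cylinder_tangent (t, x)) = DIM('a)"
proof -
  have "cylinder_tangent (t, x) = {v. (0, x) \<bullet> v = 0}"
    by (auto simp: cylinder_tangent_def inner_prod_def inner_commute)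
  moreover have "(0::real, x) \<noteq> 0" using assms by (auto simp: zero_prod_def)
  ultimately show ?thesis using dim_hyperplane[of "(0::real, x)"] by simp
qed

lemma subspace_cylinder_tangent: "subspace (cylinder_tangent p)"
  by (auto simp: subspace_def cylinder_tangent_def inner_add_left)

text \<open>One parameter point is frozen. The normal field of a rotation hypersurface is itself the
  rotation of a curve \<open>\<nu>\<close>, so a single derivative formula serves both the
  hypersurface and its normal.\<close>

locale rotational =
  fixes \<gamma> \<nu> :: "real \<Rightarrow> complex \<times> real" and \<gamma>' \<nu>' :: "complex \<times> real" and t :: real and x :: "'a::euclidean_space"
  assumes d\<gamma>: "(\<gamma> has_vector_derivative \<gamma>') (at t)" and d\<nu>: "(\<nu> has_vector_derivative \<nu>') (at t)"
    and x: "x \<in> sphere 0 1" and pos: "0 < snd (\<gamma> t)" and speed: "\<gamma>' \<noteq> 0"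
begin

lemma xx: "x \<bullet> x = 1" using x by (simp add: power2_norm_eq_inner[symmetric])

lemma tangent: "v \<in> cylinder_tangent (t, x) \<longleftrightarrow> snd v \<bullet> x = 0"
  by (simp add: cylinder_tangent_def)

abbreviation dG where "dG \<equiv> frechet_derivative (rot_hypersurface \<gamma>) (at (t, x))"

lemma linear_dG: "linear dG"
  unfolding frechet_rot[OF d\<gamma>] by (rule has_derivative_linear[OF rot_has_derivative[OF d\<gamma>]])

text \<open>The induced metric is a warped product: the curve contributes its squared speed, the
  unit sphere is scaled by the height of the curve.\<close>

lemma first_form:
  assumes "v \<in> cylinder_tangent (t, x)" "w \<in> cylinder_tangent (t, x)"
  shows "dG v \<bullet> dG w = fst v * fst w * (\<gamma>' \<bullet> \<gamma>') + (snd (\<gamma> t))\<^sup>2 * (snd v \<bullet> snd w)"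
proof -
  have *: "snd v \<bullet> x = 0" "x \<bullet> snd w = 0"
    using assms by (auto simp: tangent inner_commute)
  show ?thesis
    unfolding frechet_rot[OF d\<gamma>]
    by (simp add: inner_prod_def inner_add_left inner_add_right xx * power2_eq_square) (simp add: algebra_simps)
qed

lemma second_form:
  assumes "v \<in> cylinder_tangent (t, x)"
  shows "second_fundamental_form (rot_hypersurface \<gamma>) (rot_hypersurface \<nu>) (t, x) v v =
    - (fst v)\<^sup>2 * (\<nu>' \<bullet> \<gamma>') - snd (\<nu> t) * snd (\<gamma> t) * (snd v \<bullet> snd v)"
proof -
  have *: "snd v \<bullet> x = 0" "x \<bullet> snd v = 0"
    using assms by (auto simp: tangent inner_commute)
  show ?thesis
    unfolding frechet_rot[OF d\<gamma>] frechet_rot[OF d\<nu>] second_fundamental_form_def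
    by (simp add: inner_prod_def inner_add_left inner_add_right xx * power2_eq_square) (simp add: algebra_simps)
qed

lemma inj_on_dG: "inj_on dG (cylinder_tangent (t, x))"
proof (rule inj_onI)
  fix v w assume v: "v \<in> cylinder_tangent (t, x)" and w: "w \<in> cylinder_tangent (t, x)" and eq: "dG v = dG w"
  have vw: "v - w \<in> cylinder_tangent (t, x)"
    using v w by (simp add: tangent inner_diff_left)
  have "dG (v - w) = 0" using eq linear_diff[OF linear_dG] by simp
  then have "(fst (v - w))\<^sup>2 * (\<gamma>' \<bullet> \<gamma>') + (snd (\<gamma> t))\<^sup>2 * (snd (v - w) \<bullet> snd (v - w)) = 0"
    using first_form[OF vw vw] by (simp add: power2_eq_square)
  moreover have "(fst (v - w))\<^sup>2 * (\<gamma>' \<bullet> \<gamma>') \<ge> 0" "(snd (\<gamma> t))\<^sup>2 * (snd (v - w) \<bullet> snd (v - w)) \<ge> 0"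
    by auto
  ultimately have "(fst (v - w))\<^sup>2 * (\<gamma>' \<bullet> \<gamma>') = 0" "(snd (\<gamma> t))\<^sup>2 * (snd (v - w) \<bullet> snd (v - w)) = 0"
    by linarith+
  then have "fst (v - w) = 0" "snd (v - w) = 0" using pos speed by auto
  then show "v = w" by (simp add: prod_eq_iff)
qed

text \<open>Needed to resolve the choice in \<open>mean_curvature\<close>. The frame consists of the
  normalized direction of the curve and an orthonormal basis of the complement of \<open>x\<close>,
  rescaled by the warping factor.\<close>

lemma orthonormal_frame_exists: "\<exists>B. orthonormal_frame (rot_hypersurface \<gamma>) (t, x) B"
proof -
  let ?T = "cylinder_tangent (t, x)"
  let ?e = "(1 / norm \<gamma>', 0) :: real \<times> 'a"
  obtain B where B: "B \<subseteq> {y. x \<bullet> y = 0}" "pairwise orthogonal B" "\<And>y. y \<in> B \<Longrightarrow> norm y = 1"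
    "span B = {y. x \<bullet> y = 0}"
    using orthonormal_basis_subspace[OF subspace_hyperplane, of x] by metis
  let ?f = "\<lambda>y. (0, (1 / snd (\<gamma> t)) *\<^sub>R y) :: real \<times> 'a"
  have lin: "linear ?f" by (auto intro!: linearI simp: scaleR_add_right)
  have sp: "span (insert ?e (?f ` B)) = ?T"
  proof (intro equalityI subsetI)
    fix v assume "v \<in> span (insert ?e (?f ` B))"
    moreover have "insert ?e (?f ` B) \<subseteq> ?T"
      using B(1) by (auto simp: tangent inner_commute)
    ultimately show "v \<in> ?T" using span_minimal[OF _ subspace_cylinder_tangent] by blast
  next
    fix v assume "v \<in> ?T"
    then have "snd (\<gamma> t) *\<^sub>R snd v \<in> span B" by (simp add: B(4) tangent inner_commute)
    then have "?f (snd (\<gamma> t) *\<^sub>R snd v) \<in> span (?f ` B)"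
      unfolding linear_span_image[OF lin] by (rule imageI)
    then have "(0, snd v) \<in> span (insert ?e (?f ` B))"
      using pos span_mono[of "?f ` B" "insert ?e (?f ` B)"] by auto
    moreover have "(fst v * norm \<gamma>') *\<^sub>R ?e \<in> span (insert ?e (?f ` B))"
      by (intro span_scale span_base) simp
    ultimately have "(0, snd v) + (fst v * norm \<gamma>') *\<^sub>R ?e \<in> span (insert ?e (?f ` B))"
      by (intro span_add)
    then show "v \<in> span (insert ?e (?f ` B))" using speed by simp
  qed
  have eT: "?e \<in> ?T" and fT: "\<And>y. y \<in> B \<Longrightarrow> ?f y \<in> ?T"
    using B(1) by (auto simp: tangent inner_commute)
  have nB: "y \<bullet> y = 1" if "y \<in> B" for y using B(3)[OF that] by (simp add: power2_norm_eq_inner[symmetric])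
  have oB: "y \<bullet> z = 0" if "y \<in> B" "z \<in> B" "y \<noteq> z" for y z
    using B(2) that by (auto simp: pairwise_def orthogonal_def)
  have gn: "\<gamma>' \<bullet> \<gamma>' = norm \<gamma>' * norm \<gamma>'" by (simp add: power2_norm_eq_inner[symmetric] power2_eq_square)
  have "orthonormal_frame (rot_hypersurface \<gamma>) (t, x) (insert ?e (?f ` B))"
    unfolding orthonormal_frame_def
    using sp pos speed eT fT nB oB
    by (auto simp: first_form power2_eq_square gn)
  then show ?thesis by blast
qed

text \<open>The chosen frame is unknown, so the trace is computed for an arbitrary one. The second
  fundamental form combines only the squares of the two components of \<open>v\<close>, hence two
  sums over \<open>B\<close> determine it.\<close>

lemma trace_orthonormal_frame:
  assumes B: "orthonormal_frame (rot_hypersurface \<gamma>) (t, x) B"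
  shows "(\<Sum>v\<in>B. second_fundamental_form (rot_hypersurface \<gamma>) (rot_hypersurface \<nu>) (t, x) v v) =
    - (\<nu>' \<bullet> \<gamma>') / (\<gamma>' \<bullet> \<gamma>') - (real DIM('a) - 1) * snd (\<nu> t) / snd (\<gamma> t)"
proof -
  let ?T = "cylinder_tangent (t, x)"
  let ?E = "\<gamma>' \<bullet> \<gamma>'"
  have sp: "span B = ?T" and on: "\<And>v w. v \<in> B \<Longrightarrow> w \<in> B \<Longrightarrow> dG v \<bullet> dG w = (if v = w then 1 else 0)"
    using B by (auto simp: orthonormal_frame_def)
  have BT: "v \<in> ?T" if "v \<in> B" for v using sp that span_base by blast
  \<comment> \<open>Pairing with a frame vector extracts a coefficient. This yields independence,
    hence finiteness and the cardinality of \<open>B\<close>, and later the coefficients of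
    \<open>(1, 0)\<close>.\<close>
  have lc: "dG (\<Sum>v\<in>S. u v *\<^sub>R v) \<bullet> dG w = u w" if "finite S" "S \<subseteq> B" "w \<in> S" for S u w
  proof -
    have "dG (\<Sum>v\<in>S. u v *\<^sub>R v) \<bullet> dG w = (\<Sum>v\<in>S. u v * (dG v \<bullet> dG w))"
      by (simp add: linear_sum[OF linear_dG] linear_scale[OF linear_dG] inner_sum_left)
    also have "\<dots> = (\<Sum>v\<in>S. if v = w then u v else 0)"
      by (intro sum.cong refl) (simp add: on subsetD[OF that(2)] that(3))
    finally show ?thesis using that by simp
  qed
  have ind: "independent B"
    unfolding independent_explicit_finite_subsets
  proof (intro allI impI ballI)
    fix S u v assume "S \<subseteq> B" "finite S" "(\<Sum>v\<in>S. u v *\<^sub>R v) = 0" "v \<in> S"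
    then show "u v = 0" using lc[of S v u] by (simp add: linear_0[OF linear_dG])
  qed
  then have fin: "finite B" by (rule independent_imp_finite)
  have card: "card B = DIM('a)"
    using dim_span_eq_card_independent[OF ind] sp dim_cylinder_tangent[OF x, of t] by simp
  have E: "?E > 0" using speed by simp
  \<comment> \<open>Expanding \<open>(1, 0)\<close> in the frame gives the coefficients
    \<open>?E * fst w\<close>; comparing first components evaluates the first of the two
    sums.\<close>
  have "(1, 0) \<in> span B" by (simp add: sp tangent)
  then obtain u where u: "(1, 0) = (\<Sum>v\<in>B. u v *\<^sub>R v)"
    unfolding span_finite[OF fin] by auto
  have uw: "u w = ?E * fst w" if "w \<in> B" for w
  proof -
    have "u w = dG (1, 0) \<bullet> dG w" unfolding u using lc[OF fin _ that] by simp
    then show ?thesis using first_form[of "(1,0)" w] BT[OF that] by (simp add: tangent)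
  qed
  have "1 = fst (\<Sum>v\<in>B. u v *\<^sub>R v)" using u by (metis fst_conv)
  also have "\<dots> = (\<Sum>v\<in>B. ?E * (fst v)\<^sup>2)"
    by (auto simp: fst_sum uw power2_eq_square intro!: sum.cong)
  finally have s1: "(\<Sum>v\<in>B. (fst v)\<^sup>2) = 1 / ?E"
    using E by (simp add: sum_distrib_left[symmetric] field_simps)
  \<comment> \<open>The second sum follows by counting: each of the \<open>DIM('a)\<close> frame
    vectors has length one.\<close>
  have "real (card B) = (\<Sum>v\<in>B. dG v \<bullet> dG v)" by (simp add: on)
  also have "\<dots> = (\<Sum>v\<in>B. (fst v)\<^sup>2 * ?E + (snd (\<gamma> t))\<^sup>2 * (snd v \<bullet> snd v))"
    by (intro sum.cong) (auto simp: first_form BT power2_eq_square)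
  also have "\<dots> = 1 + (snd (\<gamma> t))\<^sup>2 * (\<Sum>v\<in>B. snd v \<bullet> snd v)"
    using E by (simp add: sum.distrib sum_distrib_left[symmetric] sum_distrib_right[symmetric] s1)
  finally have s2: "(\<Sum>v\<in>B. snd v \<bullet> snd v) = (real DIM('a) - 1) / (snd (\<gamma> t))\<^sup>2"
    using pos by (simp add: card field_simps)
  have "(\<Sum>v\<in>B. second_fundamental_form (rot_hypersurface \<gamma>) (rot_hypersurface \<nu>) (t, x) v v)
    = (\<Sum>v\<in>B. - (\<nu>' \<bullet> \<gamma>') * (fst v)\<^sup>2 - snd (\<nu> t) * snd (\<gamma> t) * (snd v \<bullet> snd v))"
    by (intro sum.cong) (auto simp: second_form BT)
  also have "\<dots> = - (\<nu>' \<bullet> \<gamma>') * (\<Sum>v\<in>B. (fst v)\<^sup>2) - snd (\<nu> t) * snd (\<gamma> t) * (\<Sum>v\<in>B. snd v \<bullet> snd v)"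
    by (simp add: sum_subtractf sum_distrib_left)
  also have "\<dots> = - (\<nu>' \<bullet> \<gamma>') / ?E - (real DIM('a) - 1) * snd (\<nu> t) / snd (\<gamma> t)"
    using pos unfolding s1 s2 by (simp add: power2_eq_square)
  finally show ?thesis .
qed

lemma mean_curvature_rot:
  "mean_curvature (rot_hypersurface \<gamma>) (rot_hypersurface \<nu>) (t, x) =
    - (\<nu>' \<bullet> \<gamma>') / (\<gamma>' \<bullet> \<gamma>') - (real DIM('a) - 1) * snd (\<nu> t) / snd (\<gamma> t)"
  unfolding mean_curvature_def
  by (intro trace_orthonormal_frame someI_ex[OF orthonormal_frame_exists])

end

section \<open>Hypersurfaces generated by a solution of the Delaunay equation\<close>

text \<open>Writing \<open>n = m + 3\<close> removes the truncated subtractions in the exponents;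
  all later formulas use \<open>m\<close>.\<close>

lemma L_fun_add3: "L_fun (m + 3) s = cos s * sin s ^ (m + 1)"
  by (simp add: L_fun_def numeral_3_eq_3)

lemma R_fun_add3: "R_fun (m + 3) h C s = C + h / (real m + 2) * sin s ^ (m + 2)"
proof -
  have "m + 3 - 1 = m + 2" "real (m + 3) - 1 = real m + 2" by simp_all
  then show ?thesis unfolding R_fun_def by metis
qed

definition L_deriv :: "nat \<Rightarrow> real \<Rightarrow> real" where
  "L_deriv m s = - (sin s ^ (m + 2)) + (real m + 1) * (cos s)\<^sup>2 * sin s ^ m"

lemma DERIV_L_fun: "(L_fun (m + 3) has_real_derivative L_deriv m s) (at s)"
proof -
  have "((\<lambda>s. cos s * sin s ^ (m + 1)) has_real_derivative
    - sin s * sin s ^ (m + 1) + real (m + 1) * (cos s * sin s ^ (m + 1 - Suc 0)) * cos s) (at s)"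
    by (rule DERIV_mult[OF DERIV_cos DERIV_power[OF DERIV_sin]])
  then show ?thesis
    by (simp add: L_fun_add3[abs_def] L_deriv_def power2_eq_square algebra_simps)
qed

lemma DERIV_R_fun: "(R_fun (m + 3) h C has_real_derivative h * L_fun (m + 3) s) (at s)"
proof -
  have "((\<lambda>s. C + h / (real m + 2) * sin s ^ (m + 2)) has_real_derivative
     0 + h / (real m + 2) * (real (m + 2) * (cos s * sin s ^ (m + 2 - Suc 0)))) (at s)"
    by (intro DERIV_add DERIV_const DERIV_cmult DERIV_power DERIV_sin)
  moreover have "0 + h / (real m + 2) * (real (m + 2) * (cos s * sin s ^ (m + 2 - Suc 0))) =
      h * (cos s * sin s ^ (m + 1))"
  proof -
    have *: "0 + h / a * (a * (x * y)) = h * (x * y)" if "a \<noteq> 0" for a x y :: real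
      using that by simp
    have e: "real (m + 2) = real m + 2" "m + 2 - Suc 0 = m + 1" by simp_all
    show ?thesis unfolding e by (rule *) simp
  qed
  ultimately show ?thesis
    by (simp only: R_fun_add3[abs_def] L_fun_add3)
qed

lemma L_fun_pos: "0 < s \<Longrightarrow> s < pi / 2 \<Longrightarrow> 0 < L_fun (m + 3) s"
  using cos_gt_zero[of s] sin_gt_zero[of s] pi_gt_zero by (auto simp: L_fun_add3 simp del: pi_gt_zero)

lemma R_fun_pos: "0 < C \<Longrightarrow> 0 \<le> h \<Longrightarrow> 0 \<le> s \<Longrightarrow> s \<le> pi / 2 \<Longrightarrow> 0 < R_fun (m + 3) h C s"
  using sin_ge_zero[of s] pi_gt_zero by (auto simp: R_fun_add3 intro!: add_pos_nonneg mult_nonneg_nonneg simp del: pi_gt_zero)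

text \<open>Half the derivative of the energy \<open>cos\<^sup>2 s (L\<^sup>2 / R\<^sup>2 - 1)\<close>.\<close>

definition accel :: "nat \<Rightarrow> real \<Rightarrow> real \<Rightarrow> real \<Rightarrow> real" where
  "accel m h C s = (let L = L_fun (m + 3) s; R = R_fun (m + 3) h C s in
     - sin s * cos s * (L\<^sup>2 / R\<^sup>2 - 1) + (cos s)\<^sup>2 * (L * L_deriv m s / R\<^sup>2 - h * L ^ 3 / R ^ 3))"

definition energy :: "nat \<Rightarrow> real \<Rightarrow> real \<Rightarrow> real \<Rightarrow> real" where
  "energy m h C s = (cos s)\<^sup>2 * ((L_fun (m + 3) s)\<^sup>2 / (R_fun (m + 3) h C s)\<^sup>2 - 1)"

lemma DERIV_energy:
  assumes "R_fun (m + 3) h C s \<noteq> 0"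
  shows "(energy m h C has_real_derivative 2 * accel m h C s) (at s)"
proof -
  let ?L = "L_fun (m + 3)" and ?R = "R_fun (m + 3) h C" and ?L' = "L_deriv m s"
  have "((\<lambda>s. (cos s)\<^sup>2 * ((?L s / ?R s)\<^sup>2 - 1)) has_real_derivative
    2 * cos s * (- sin s) * ((?L s / ?R s)\<^sup>2 - 1) +
      2 * (?L s / ?R s) * ((?L' * ?R s - ?L s * (h * ?L s)) / (?R s * ?R s)) * (cos s)\<^sup>2) (at s)"
    using assms by (auto intro!: derivative_eq_intros DERIV_L_fun DERIV_R_fun simp: mult_ac)
  moreover have "2 * cos s * (- sin s) * ((?L s / ?R s)\<^sup>2 - 1) +
      2 * (?L s / ?R s) * ((?L' * ?R s - ?L s * (h * ?L s)) / (?R s * ?R s)) * (cos s)\<^sup>2 = 2 * accel m h C s"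
    using assms unfolding accel_def Let_def power_divide
    by (simp add: field_simps power2_eq_square power3_eq_cube)
  ultimately show ?thesis unfolding energy_def[abs_def] power_divide by simp
qed

text \<open>The second-order equation is assumed beside the energy identity because the latter, when
  differentiated, gives no information on the derivative of \<open>v\<close> at a turning point,
  where \<open>v\<close> vanishes.\<close>

locale delaunay_motion =
  fixes m :: nat and h C :: real and r v :: "real \<Rightarrow> real"
  assumes C: "0 < C" and h: "0 < h"
    and r: "\<And>t. 0 < r t" "\<And>t. r t < pi / 2"
    and dr: "\<And>t. (r has_real_derivative v t) (at t)"
    and dv: "\<And>t. (v has_real_derivative accel m h C (r t)) (at t)"
    and energy: "\<And>t. (v t)\<^sup>2 = energy m h C (r t)"
begin

abbreviation L where "L t \<equiv> L_fun (m + 3) (r t)"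
abbreviation R where "R t \<equiv> R_fun (m + 3) h C (r t)"

lemma sin_pos: "0 < sin (r t)" using r[of t] pi_gt_zero by (intro sin_gt_zero) linarith+
lemma cos_pos: "0 < cos (r t)" using r[of t] by (intro cos_gt_zero) linarith+
lemma L_pos: "0 < L t" using r[of t] by (rule L_fun_pos)
lemma R_pos: "0 < R t" using C h r[of t] by (intro R_fun_pos) linarith+

lemmas nonzero [simp] = sin_pos[THEN less_imp_neq, symmetric] cos_pos[THEN less_imp_neq, symmetric]
  L_pos[THEN less_imp_neq, symmetric] R_pos[THEN less_imp_neq, symmetric]

section \<open>The generating curve and its normal in the rotating frame \<open>cis t\<close>,
  \<open>\<i> * cis t\<close>\<close>

definition \<gamma> :: "real \<Rightarrow> complex \<times> real" where
  "\<gamma> t = (of_real (cos (r t)) * cis t, sin (r t))"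

definition \<gamma>' :: "real \<Rightarrow> complex \<times> real" where
  "\<gamma>' t = (of_real (- sin (r t) * v t) * cis t + of_real (cos (r t)) * (\<i> * cis t), cos (r t) * v t)"

definition \<gamma>'' :: "real \<Rightarrow> complex \<times> real" where
  "\<gamma>'' t = (of_real (- cos (r t) * (v t)\<^sup>2 - sin (r t) * accel m h C (r t) - cos (r t)) * cis t +
      of_real (- 2 * sin (r t) * v t) * (\<i> * cis t),
    - sin (r t) * (v t)\<^sup>2 + cos (r t) * accel m h C (r t))"

text \<open>Up to sign the cross product of \<open>\<gamma>\<close> and \<open>\<gamma>'\<close> in
  the rotating frame, divided by the speed \<open>cos (r t) * L t / R t\<close>. The sign makes the
  last component negative, so the normal points toward the great circle.\<close>

definition \<nu> :: "real \<Rightarrow> complex \<times> real" where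
  "\<nu> t = (of_real (R t / L t * sin (r t)) * cis t + of_real (v t * R t / (cos (r t) * L t)) * (\<i> * cis t),
    - (R t / L t * cos (r t)))"

lemma inner_frame:
  "(of_real a * cis t + of_real b * (\<i> * cis t)) \<bullet> (of_real c * cis t + of_real d * (\<i> * cis t)) = a * c + b * d"
  unfolding inner_complex_def by simp (use sin_cos_squared_add3[of t] in algebra)

lemma frame_deriv:
  assumes "(a has_real_derivative a') (at t)" "(b has_real_derivative b') (at t)"
  shows "((\<lambda>t. of_real (a t) * cis t + of_real (b t) * (\<i> * cis t)) has_vector_derivative
    of_real (a' - b t) * cis t + of_real (b' + a t) * (\<i> * cis t)) (at t)"
proof -
  have a: "((\<lambda>t. complex_of_real (a t)) has_vector_derivative of_real a') (at t)"
    and b: "((\<lambda>t. complex_of_real (b t)) has_vector_derivative of_real b') (at t)"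
    using assms by (auto intro!: has_vector_derivative_of_real simp: has_real_derivative_iff_has_vector_derivative)
  have c: "(cis has_vector_derivative \<i> * cis t) (at t)"
    using has_derivative_cis[OF has_derivative_ident, of t UNIV]
    by (simp add: has_vector_derivative_def scaleR_conv_of_real mult_ac)
  show ?thesis
    by (rule has_vector_derivative_eq_rhs[OF has_vector_derivative_add[OF has_vector_derivative_mult[OF a c]
      has_vector_derivative_mult[OF b has_vector_derivative_mult_right[OF c]]]])
      (simp add: algebra_simps)
qed

lemma d\<gamma>: "(\<gamma> has_vector_derivative \<gamma>' t) (at t)"
proof -
  have c: "((\<lambda>t. cos (r t)) has_real_derivative - sin (r t) * v t) (at t)"
    and s: "((\<lambda>t. sin (r t)) has_real_derivative cos (r t) * v t) (at t)"
    by (auto intro!: derivative_eq_intros dr)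
  show ?thesis
    using has_vector_derivative_Pair[OF frame_deriv[OF c DERIV_const[of 0]]
      s[unfolded has_real_derivative_iff_has_vector_derivative]]
    by (simp add: \<gamma>_def[abs_def] \<gamma>'_def)
qed

lemma d\<gamma>': "(\<gamma>' has_vector_derivative \<gamma>'' t) (at t)"
proof -
  have 1: "((\<lambda>t. - sin (r t) * v t) has_real_derivative
      - cos (r t) * (v t)\<^sup>2 - sin (r t) * accel m h C (r t)) (at t)"
    and 2: "((\<lambda>t. cos (r t)) has_real_derivative - sin (r t) * v t) (at t)"
    and 3: "((\<lambda>t. cos (r t) * v t) has_real_derivative
      - sin (r t) * (v t)\<^sup>2 + cos (r t) * accel m h C (r t)) (at t)"
    by (auto intro!: derivative_eq_intros dr dv simp: power2_eq_square)
  show ?thesis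
    using has_vector_derivative_Pair[OF frame_deriv[OF 1 2]
      3[unfolded has_real_derivative_iff_has_vector_derivative]]
    by (simp add: \<gamma>'_def[abs_def] \<gamma>''_def mult_ac)
qed

text \<open>Existence suffices: the curvature involves the derivative of \<open>\<nu>\<close> only
  through its product with \<open>\<gamma>'\<close>, which is found without computing it.\<close>

lemma d\<nu>: "\<exists>\<nu>'. (\<nu> has_vector_derivative \<nu>') (at t)"
proof -
  have LR: "(L has_real_derivative L_deriv m (r t) * v t) (at t)" "(R has_real_derivative h * L t * v t) (at t)"
    by (auto intro: DERIV_chain2 DERIV_L_fun DERIV_R_fun dr)
  have d: "L field_differentiable at t" "R field_differentiable at t" "v field_differentiable at t"
    "(\<lambda>t. sin (r t)) field_differentiable at t" "(\<lambda>t. cos (r t)) field_differentiable at t"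
    using LR dv by (auto simp: field_differentiable_def intro!: exI derivative_eq_intros dr)
  obtain a' b' c' where
    "((\<lambda>t. R t / L t * sin (r t)) has_real_derivative a') (at t)"
    "((\<lambda>t. v t * R t / (cos (r t) * L t)) has_real_derivative b') (at t)"
    "((\<lambda>t. - (R t / L t * cos (r t))) has_real_derivative c') (at t)"
  proof -
    have "(\<lambda>t. R t / L t * sin (r t)) field_differentiable at t"
      "(\<lambda>t. v t * R t / (cos (r t) * L t)) field_differentiable at t"
      "(\<lambda>t. - (R t / L t * cos (r t))) field_differentiable at t"
      by (intro field_differentiable_mult field_differentiable_divide field_differentiable_minus d; simp)+
    then show ?thesis using that by (auto simp: field_differentiable_def)
  qed
  then show ?thesis
    using has_vector_derivative_Pair[OF frame_deriv]
    unfolding \<nu>_def[abs_def] has_real_derivative_iff_has_vector_derivative by blast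
qed

lemma \<nu>\<gamma>': "\<nu> t \<bullet> \<gamma>' t = 0"
  unfolding \<nu>_def \<gamma>'_def inner_prod_def fst_conv snd_conv inner_frame
  by (simp add: field_simps power2_eq_square) (use sin_cos_squared_add3[of "r t"] in algebra)

lemma \<nu>\<gamma>: "\<nu> t \<bullet> \<gamma> t = 0"
  using inner_frame[of "R t / L t * sin (r t)" t "v t * R t / (cos (r t) * L t)" "cos (r t)" 0]
  unfolding \<nu>_def \<gamma>_def inner_prod_def by simp

lemma v2: "(v t)\<^sup>2 = (cos (r t))\<^sup>2 * ((L t)\<^sup>2 / (R t)\<^sup>2 - 1)"
  using energy[of t] by (simp add: energy_def)

text \<open>The squared speed is \<open>v\<^sup>2 + cos\<^sup>2\<close>, and the energy identity
  turns this sum into a perfect square.\<close>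

lemma speed: "\<gamma>' t \<bullet> \<gamma>' t = (cos (r t) * L t / R t)\<^sup>2"
proof -
  have "\<gamma>' t \<bullet> \<gamma>' t = (v t)\<^sup>2 + (cos (r t))\<^sup>2"
    unfolding \<gamma>'_def inner_prod_def fst_conv snd_conv inner_frame
    by (simp add: algebra_simps power2_eq_square) (use sin_cos_squared_add3[of "r t"] in algebra)
  then show ?thesis by (simp add: v2 algebra_simps power_mult_distrib power_divide)
qed

lemma norm_\<nu>: "norm (\<nu> t) = 1"
proof -
  have "\<nu> t \<bullet> \<nu> t = (R t / L t)\<^sup>2 + (v t)\<^sup>2 * (R t)\<^sup>2 / ((cos (r t))\<^sup>2 * (L t)\<^sup>2)"
    unfolding \<nu>_def inner_prod_def fst_conv snd_conv inner_frame
    by (simp add: field_simps power2_eq_square) (use sin_cos_squared_add3[of "r t"] in algebra)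
  also have "\<dots> = 1"
    by (simp add: v2 field_simps)
  finally show ?thesis by (simp add: norm_eq_sqrt_inner)
qed

text \<open>The subtracted term is the sum of the \<open>m + 1\<close> equal principal curvatures
  along the sphere; \<open>accel\<close> is exactly the acceleration for which the curvature of the
  curve completes the trace to \<open>h\<close>.\<close>

lemma \<nu>\<gamma>'': "\<nu> t \<bullet> \<gamma>'' t = (h - (real m + 1) * (R t * cos (r t) / (L t * sin (r t)))) * (\<gamma>' t \<bullet> \<gamma>' t)"
proof -
  let ?s = "sin (r t)" and ?c = "cos (r t)"
  have "\<nu> t \<bullet> \<gamma>'' t = - (R t / L t) * (accel m h C (r t) + ?s * ?c) - 2 * ?s * (v t)\<^sup>2 * R t / (?c * L t)"
    unfolding \<nu>_def \<gamma>''_def inner_prod_def fst_conv snd_conv inner_frame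
    by (simp add: field_simps power2_eq_square) (use sin_cos_squared_add3[of "r t"] in algebra)
  also have "\<dots> = ?s * ?c * L t / R t - ?c\<^sup>2 * L_deriv m (r t) / R t + ?c\<^sup>2 * h * (L t)\<^sup>2 / (R t)\<^sup>2
      - 2 * ?s * ?c * L t / R t"
    unfolding v2 accel_def Let_def
    by (simp add: field_simps power2_eq_square power3_eq_cube)
  \<comment> \<open>The logarithmic derivative of \<open>L\<close> is
    \<open>- tan + (m + 1) * cot\<close>; after inserting it, both sides are rational expressions
    that can be compared.\<close>
  also have "L_deriv m (r t) = - ?s / ?c * L t + (real m + 1) * ?c / ?s * L t"
    by (simp add: L_deriv_def L_fun_add3 field_simps power2_eq_square)
  also have "?s * ?c * L t / R t - ?c\<^sup>2 * (- ?s / ?c * L t + (real m + 1) * ?c / ?s * L t) / R t +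
      ?c\<^sup>2 * h * (L t)\<^sup>2 / (R t)\<^sup>2 - 2 * ?s * ?c * L t / R t =
      (h - (real m + 1) * (R t * ?c / (L t * ?s))) * (?c * L t / R t)\<^sup>2"
    by (simp add: field_simps power2_eq_square)
  finally show ?thesis unfolding speed .
qed

text \<open>Weingarten equation: differentiating \<open>\<nu> t \<bullet> \<gamma>' t = 0\<close>
  trades the derivative of the normal for the second derivative of the curve.\<close>

lemma curvature:
  assumes "(\<nu> has_vector_derivative \<nu>') (at t)"
  shows "- (\<nu>' \<bullet> \<gamma>' t) / (\<gamma>' t \<bullet> \<gamma>' t) = h - (real m + 1) * (R t * cos (r t) / (L t * sin (r t)))"
proof -
  have "((\<lambda>t. \<nu> t \<bullet> \<gamma>' t) has_derivative (\<lambda>\<tau>. \<nu> t \<bullet> (\<tau> *\<^sub>R \<gamma>'' t) + (\<tau> *\<^sub>R \<nu>') \<bullet> \<gamma>' t)) (at t)"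
    using assms d\<gamma>'[of t] unfolding has_vector_derivative_def by (rule has_derivative_inner)
  moreover have "((\<lambda>t. \<nu> t \<bullet> \<gamma>' t) has_derivative (\<lambda>\<tau>. 0)) (at t)"
    by (simp add: \<nu>\<gamma>')
  ultimately have "(\<lambda>\<tau>. \<nu> t \<bullet> (\<tau> *\<^sub>R \<gamma>'' t) + (\<tau> *\<^sub>R \<nu>') \<bullet> \<gamma>' t) = (\<lambda>\<tau>. 0)"
    by (rule has_derivative_unique)
  from fun_cong[OF this, of 1] have "- (\<nu>' \<bullet> \<gamma>' t) = \<nu> t \<bullet> \<gamma>'' t" by simp
  moreover have "\<gamma>' t \<bullet> \<gamma>' t \<noteq> 0" unfolding speed by simp
  ultimately show ?thesis by (simp add: \<nu>\<gamma>'')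
qed

text \<open>The list is chosen so that it closes under differentiation. \<open>L\<close> and
  \<open>R\<close> are polynomials in it; \<open>1 / L\<close> is a product of the reciprocals of
  cosine and sine, whereas \<open>1 / R\<close> has to be listed.\<close>

definition generators :: "(real \<times> 'a::euclidean_space \<Rightarrow> real) set" where
  "generators = (\<lambda>f p. f (fst p)) `
      {v, cos, sin, \<lambda>t. sin (r t), \<lambda>t. cos (r t), \<lambda>t. 1 / sin (r t), \<lambda>t. 1 / cos (r t), \<lambda>t. 1 / R t} \<union>
    range (\<lambda>i p. snd p \<bullet> i)"

abbreviation alg :: "(real \<times> 'a::euclidean_space \<Rightarrow> real) \<Rightarrow> bool" where
  "alg \<equiv> fun_alg generators"

lemma alg_base:
  "alg (\<lambda>p. v (fst p))" "alg (\<lambda>p. cos (fst p))" "alg (\<lambda>p. sin (fst p))"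
  "alg (\<lambda>p. sin (r (fst p)))" "alg (\<lambda>p. cos (r (fst p)))"
  "alg (\<lambda>p. 1 / sin (r (fst p)))" "alg (\<lambda>p. 1 / cos (r (fst p)))"
  "alg (\<lambda>p. 1 / R (fst p))" "alg (\<lambda>p. snd p \<bullet> i)"
  by (auto simp: generators_def intro!: fun_alg.gen)

lemma alg_LR: "alg (\<lambda>p. L (fst p))" "alg (\<lambda>p. R (fst p))" "alg (\<lambda>p. 1 / L (fst p))"
  "alg (\<lambda>p. L_deriv m (r (fst p)))"
proof -
  show "alg (\<lambda>p. L (fst p))" "alg (\<lambda>p. R (fst p))" "alg (\<lambda>p. L_deriv m (r (fst p)))"
    unfolding L_fun_add3 R_fun_add3 L_deriv_def by (intro fun_alg_intros alg_base)+
  have "alg (\<lambda>p. 1 / cos (r (fst p)) * (1 / sin (r (fst p))) ^ (m + 1))"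
    by (intro fun_alg_intros alg_base)
  then show "alg (\<lambda>p. 1 / L (fst p))"
    by (simp add: L_fun_add3 power_divide)
qed

lemma alg_accel: "alg (\<lambda>p. accel m h C (r (fst p)))"
proof -
  have "alg (\<lambda>p. - (sin (r (fst p)) * cos (r (fst p))) * ((L (fst p))\<^sup>2 * (1 / R (fst p))\<^sup>2 - 1) +
      (cos (r (fst p)))\<^sup>2 * (L (fst p) * L_deriv m (r (fst p)) * (1 / R (fst p))\<^sup>2 - h * L (fst p) ^ 3 * (1 / R (fst p)) ^ 3))"
    by (intro fun_alg_intros alg_base alg_LR)
  then show ?thesis by (simp add: accel_def Let_def power_divide)
qed

lemma generators_derivative:
  fixes f :: "real \<times> 'a::euclidean_space \<Rightarrow> real"
  assumes "f \<in> generators"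
  shows "\<exists>f'. (\<forall>x. (f has_derivative f' x) (at x)) \<and> (\<forall>w. alg (\<lambda>x. f' x w))"
proof -
  have *: "\<exists>f'. (\<forall>x::real \<times> 'a. ((\<lambda>p. g (fst p)) has_derivative f' x) (at x)) \<and> (\<forall>w. alg (\<lambda>x. f' x w))"
    if "\<And>t. (g has_real_derivative g' t) (at t)" "alg (\<lambda>p::real \<times> 'a. g' (fst p))" for g g' :: "real \<Rightarrow> real"
  proof (intro exI conjI allI)
    fix x :: "real \<times> 'a"
    show "((\<lambda>p. g (fst p)) has_derivative (\<lambda>w. g' (fst x) * fst w)) (at x)"
      using has_derivative_compose[OF has_derivative_fst[OF has_derivative_ident, of "at x"],
          of g "\<lambda>\<tau>. g' (fst x) * \<tau>"] that(1)[of "fst x"]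
      by (simp add: has_field_derivative_def)
  next
    fix w :: "real \<times> 'a"
    show "alg (\<lambda>x::real \<times> 'a. g' (fst x) * fst w)" using that(2) by (intro fun_alg_intros)
  qed
  have ds: "((\<lambda>t. sin (r t)) has_real_derivative cos (r t) * v t) (at t)"
    and dc: "((\<lambda>t. cos (r t)) has_real_derivative - (sin (r t)) * v t) (at t)"
    and ds': "((\<lambda>t. 1 / sin (r t)) has_real_derivative - (cos (r t) * v t * (1 / sin (r t))\<^sup>2)) (at t)"
    and dc': "((\<lambda>t. 1 / cos (r t)) has_real_derivative sin (r t) * v t * (1 / cos (r t))\<^sup>2) (at t)"
    and dR': "((\<lambda>t. 1 / R t) has_real_derivative - (h * L t * v t * (1 / R t)\<^sup>2)) (at t)" for t
    by (auto intro!: derivative_eq_intros dr DERIV_chain2[OF DERIV_R_fun dr] simp: power2_eq_square)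
  consider "f \<in> (\<lambda>f p. f (fst p)) ` {v, cos, sin, \<lambda>t. sin (r t), \<lambda>t. cos (r t), \<lambda>t. 1 / sin (r t), \<lambda>t. 1 / cos (r t), \<lambda>t. 1 / R t}"
    | i where "f = (\<lambda>p. snd p \<bullet> i)"
    using assms unfolding generators_def by blast
  then show ?thesis
  proof cases
    case 1
    then show ?thesis
      apply (elim imageE insertE emptyE; hypsubst)
      subgoal by (rule *[OF dv]) (intro fun_alg_intros alg_base alg_LR alg_accel)
      subgoal by (rule *[OF DERIV_cos]) (intro fun_alg_intros alg_base alg_LR alg_accel)
      subgoal by (rule *[OF DERIV_sin]) (intro fun_alg_intros alg_base alg_LR alg_accel)
      subgoal by (rule *[OF ds]) (intro fun_alg_intros alg_base alg_LR alg_accel)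
      subgoal by (rule *[OF dc]) (intro fun_alg_intros alg_base alg_LR alg_accel)
      subgoal by (rule *[OF ds']) (intro fun_alg_intros alg_base alg_LR alg_accel)
      subgoal by (rule *[OF dc']) (intro fun_alg_intros alg_base alg_LR alg_accel)
      subgoal by (rule *[OF dR']) (intro fun_alg_intros alg_base alg_LR alg_accel)
      done
  next
    case 2
    then show ?thesis
      by (intro exI[of _ "\<lambda>_ w. snd w \<bullet> i"])
        (auto intro!: derivative_eq_intros fun_alg.const)
  qed
qed

lemma smooth_rot:
  assumes "alg (\<lambda>p :: real \<times> 'a. Re (fst (\<eta> (fst p))))" "alg (\<lambda>p :: real \<times> 'a. Im (fst (\<eta> (fst p))))"
    "alg (\<lambda>p :: real \<times> 'a. snd (\<eta> (fst p)))"
  shows "smooth (rot_hypersurface \<eta> :: real \<times> 'a::euclidean_space \<Rightarrow> complex \<times> 'a)"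
proof (rule smooth_fun_alg[OF generators_derivative])
  fix i :: "complex \<times> 'a" assume "i \<in> Basis"
  then show "alg (\<lambda>p. rot_hypersurface \<eta> p \<bullet> i)"
    using assms
    by (auto simp: Basis_prod_def Basis_complex_def rot_hypersurface_def case_prod_unfold inner_complex_def
      inner_prod_def intro!: fun_alg.mult alg_base)
qed

lemma smooth_\<gamma>: "smooth (rot_hypersurface \<gamma> :: real \<times> 'a::euclidean_space \<Rightarrow> complex \<times> 'a)"
  by (rule smooth_rot) (simp_all add: \<gamma>_def, (intro fun_alg_intros alg_base)+)

lemma smooth_\<nu>: "smooth (rot_hypersurface \<nu> :: real \<times> 'a::euclidean_space \<Rightarrow> complex \<times> 'a)"
proof (rule smooth_rot)
  have *: "alg (\<lambda>p. R (fst p) * (1 / L (fst p)) * sin (r (fst p)))"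
    "alg (\<lambda>p. v (fst p) * R (fst p) * (1 / cos (r (fst p))) * (1 / L (fst p)))"
    "alg (\<lambda>p. - (R (fst p) * (1 / L (fst p)) * cos (r (fst p))))"
    by (intro fun_alg_intros alg_base alg_LR)+
  show "alg (\<lambda>p. snd (\<nu> (fst p)))" using *(3) by (simp add: \<nu>_def)
  have "alg (\<lambda>p. R (fst p) * (1 / L (fst p)) * sin (r (fst p)) * cos (fst p) -
      v (fst p) * R (fst p) * (1 / cos (r (fst p))) * (1 / L (fst p)) * sin (fst p))"
    "alg (\<lambda>p. R (fst p) * (1 / L (fst p)) * sin (r (fst p)) * sin (fst p) +
      v (fst p) * R (fst p) * (1 / cos (r (fst p))) * (1 / L (fst p)) * cos (fst p))"
    by (intro fun_alg_intros alg_base *)+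
  then show "alg (\<lambda>p. Re (fst (\<nu> (fst p))))" "alg (\<lambda>p. Im (fst (\<nu> (fst p))))"
    by (simp_all add: \<nu>_def Re_divide_of_real Im_divide_of_real)
qed

section \<open>Immersion, unit normal, constant mean curvature and embeddedness\<close>

lemma \<gamma>'_nonzero: "\<gamma>' t \<noteq> 0"
  using speed[of t] by (metis inner_zero_left nonzero(2-4) zero_eq_power2 divide_eq_0_iff mult_eq_0_iff)

lemma profile_curve_\<gamma>: "profile_curve \<gamma>"
  by (simp add: profile_curve_def \<gamma>_def norm_prod_def norm_mult sin_pos)

lemma rot_\<gamma>_in_sphere: "p \<in> cylinder \<Longrightarrow> rot_hypersurface \<gamma> p \<in> sphere 0 1"
  by (auto simp: cylinder_def rot_hypersurface_def \<gamma>_def norm_prod_def norm_mult)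

lemma rotational_\<gamma>:
  assumes "x \<in> sphere 0 1" "(\<nu> has_vector_derivative \<nu>') (at t)"
  shows "rotational \<gamma> \<nu> (\<gamma>' t) \<nu>' t x"
  using assms d\<gamma> \<gamma>'_nonzero sin_pos by unfold_locales (auto simp: \<gamma>_def)

lemma smooth_immersion_\<gamma>:
  "smooth_immersion (rot_hypersurface \<gamma> :: real \<times> 'a::euclidean_space \<Rightarrow> complex \<times> 'a)"
  unfolding smooth_immersion_def
proof (intro conjI ballI smooth_\<gamma> rot_\<gamma>_in_sphere)
  fix p :: "real \<times> 'a" assume p: "p \<in> cylinder"
  obtain \<nu>' where "(\<nu> has_vector_derivative \<nu>') (at (fst p))" using d\<nu> by blast
  then interpret rotational \<gamma> \<nu> "\<gamma>' (fst p)" \<nu>' "fst p" "snd p"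
    using p by (intro rotational_\<gamma>) (auto simp: cylinder_def)
  show "inj_on (frechet_derivative (rot_hypersurface \<gamma>) (at p)) (cylinder_tangent p)"
    using inj_on_dG by simp
qed

lemma unit_normal_field_\<nu>:
  "unit_normal_field (rot_hypersurface \<gamma> :: real \<times> 'a::euclidean_space \<Rightarrow> complex \<times> 'a) (rot_hypersurface \<nu>)"
  unfolding unit_normal_field_def
proof (intro conjI ballI smooth_\<nu>)
  fix p :: "real \<times> 'a" assume "p \<in> cylinder"
  then obtain t x where p: "p = (t, x)" and x: "norm x = 1" by (cases p) (auto simp: cylinder_def)
  have xx: "x \<bullet> x = 1" using x by (simp add: power2_norm_eq_inner[symmetric])
  show "norm (rot_hypersurface \<nu> p) = 1"
    using norm_\<nu>[of t] x by (simp add: p rot_hypersurface_def norm_prod_def)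
  show "rot_hypersurface \<nu> p \<bullet> rot_hypersurface \<gamma> p = 0"
    using \<nu>\<gamma>[of t] xx by (simp add: p rot_hypersurface_def inner_prod_def mult_ac)
  fix w assume "w \<in> cylinder_tangent p"
  then have w: "x \<bullet> snd w = 0" by (simp add: cylinder_tangent_def p inner_commute)
  have "rot_hypersurface \<nu> p \<bullet> frechet_derivative (rot_hypersurface \<gamma>) (at p) w = fst w * (\<nu> t \<bullet> \<gamma>' t)"
    unfolding p frechet_rot[OF d\<gamma>]
    by (simp add: rot_hypersurface_def inner_prod_def inner_add_right xx w algebra_simps)
  then show "rot_hypersurface \<nu> p \<bullet> frechet_derivative (rot_hypersurface \<gamma>) (at p) w = 0"
    by (simp add: \<nu>\<gamma>')
qed

lemma constant_mean_curvature_\<gamma>: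
  assumes "DIM('a) = m + 2"
  shows "has_constant_mean_curvature
    (rot_hypersurface \<gamma> :: real \<times> 'a::euclidean_space \<Rightarrow> complex \<times> 'a) h"
  unfolding has_constant_mean_curvature_def
proof (intro exI[of _ "rot_hypersurface \<nu>"] conjI ballI unit_normal_field_\<nu>)
  fix p :: "real \<times> 'a" assume p: "p \<in> cylinder"
  obtain t x where tx: "p = (t, x)" and x: "norm x = 1" using p by (cases p) (auto simp: cylinder_def)
  obtain \<nu>' where \<nu>': "(\<nu> has_vector_derivative \<nu>') (at t)" using d\<nu> by blast
  then interpret rotational \<gamma> \<nu> "\<gamma>' t" \<nu>' t x
    using x by (intro rotational_\<gamma>) auto
  show "snd (rot_hypersurface \<nu> p) \<bullet> snd (rot_hypersurface \<gamma> p) < 0"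
    using xx by (simp add: tx rot_hypersurface_def \<nu>_def \<gamma>_def L_pos R_pos sin_pos cos_pos)
  have "snd (\<nu> t) / snd (\<gamma> t) = - (R t * cos (r t) / (L t * sin (r t)))"
    by (simp add: \<nu>_def \<gamma>_def)
  moreover have "real DIM('a) - 1 = real m + 1" using assms by simp
  ultimately show "mean_curvature (rot_hypersurface \<gamma>) (rot_hypersurface \<nu>) p = h"
    unfolding tx mean_curvature_rot curvature[OF \<nu>'] times_divide_eq_right[symmetric] by simp
qed

text \<open>Norms of the two components of an image point recover \<open>sin (r t)\<close> and
  \<open>cos (r t)\<close>. Both are positive and can be cancelled, which leaves equality of
  \<open>x\<close> and of \<open>cis t\<close>.\<close>

lemma embedded_\<gamma>:
  assumes per: "\<And>t. r (t + 2 * pi) = r t"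
  shows "embedded_with_period
    (rot_hypersurface \<gamma> :: real \<times> 'a::euclidean_space \<Rightarrow> complex \<times> 'a) (2 * pi)"
  unfolding embedded_with_period_def
proof (intro conjI allI ballI smooth_immersion_\<gamma>)
  fix t t' :: real and x x' :: 'a assume x: "x \<in> sphere 0 1" "x' \<in> sphere 0 1"
  have perm: "r (t + of_int j * (2 * pi)) = r t" for j t
  proof (induction j arbitrary: t rule: int_induct[where k = 0])
    case (step1 i)
    then show ?case using per[of "t + of_int i * (2 * pi)"] by (simp add: algebra_simps)
  next
    case (step2 i)
    then show ?case using per[of "t + of_int (i - 1) * (2 * pi)"] by (simp add: algebra_simps)
  qed simp
  show "rot_hypersurface \<gamma> (t, x) = rot_hypersurface \<gamma> (t', x') \<longleftrightarrow>
    x = x' \<and> (\<exists>j::int. t' = t + of_int j * (2 * pi))"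
  proof
    assume eq: "rot_hypersurface \<gamma> (t, x) = rot_hypersurface \<gamma> (t', x')"
    then have s: "sin (r t) *\<^sub>R x = sin (r t') *\<^sub>R x'" and
      c: "of_real (cos (r t)) * cis t = of_real (cos (r t')) * cis t'"
      by (auto simp: rot_hypersurface_def \<gamma>_def)
    from arg_cong[OF s, of norm] have ss: "sin (r t) = sin (r t')"
      using x sin_pos[of t] sin_pos[of t'] by simp
    then have xx: "x = x'" using s by simp
    from arg_cong[OF c, of norm] have "cos (r t) = cos (r t')"
      using cos_pos[of t] cos_pos[of t'] by (simp add: norm_mult)
    then have "cis t = cis t'" using c by simp
    then have "sin t' = sin t \<and> cos t' = cos t" by (simp add: complex_eq_iff)
    then obtain j :: int where "t' = t + 2 * pi * of_int j" using sin_cos_eq_iff by auto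
    then show "x = x' \<and> (\<exists>j::int. t' = t + of_int j * (2 * pi))"
      using xx by (auto simp: mult_ac)
  next
    assume "x = x' \<and> (\<exists>j::int. t' = t + of_int j * (2 * pi))"
    then obtain j :: int where j: "x = x'" "t' = t + of_int j * (2 * pi)" by blast
    have "sin t' = sin t \<and> cos t' = cos t" unfolding sin_cos_eq_iff using j(2) by (auto simp: mult_ac)
    then show "rot_hypersurface \<gamma> (t, x) = rot_hypersurface \<gamma> (t', x')"
      using perm[of t j] j by (simp add: rot_hypersurface_def \<gamma>_def complex_eq_iff)
  qed
qed simp

end

section \<open>Divided differences\<close>

text \<open>The negative of the second divided difference of a function with second derivative
  \<open>f2\<close> at the nodes \<open>a\<close>, \<open>b\<close>, \<open>s\<close>, in
  Hermite-Genocchi form. The integral stays meaningful and continuous when nodes coincide.\<close>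

definition dd :: "(real \<Rightarrow> real) \<Rightarrow> real \<Rightarrow> real \<Rightarrow> real \<Rightarrow> real" where
  "dd f2 s a b = - integral {0..1} (\<lambda>t. integral {0..1} (\<lambda>u. t * f2 (a + t * (b + u * (s - b) - a))))"

lemma continuous_dd:
  assumes "continuous_on UNIV f2"
  shows "continuous_on UNIV (\<lambda>(s, a, b). dd f2 s a b)"
proof -
  have c: "continuous_on S (\<lambda>x. f2 (k x))" if "continuous_on S k" for S and k :: "'a::topological_space \<Rightarrow> real"
    using continuous_on_compose2[OF assms that] by simp
  have 1: "continuous_on ((UNIV :: ((real \<times> real \<times> real) \<times> real) set) \<times> cbox 0 1)
    (\<lambda>(p, u). (\<lambda>((s, a, b), t) u. t * f2 (a + t * (b + u * (s - b) - a))) p u)"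
    unfolding case_prod_unfold by (intro continuous_intros c)
  have 2: "continuous_on ((UNIV :: (real \<times> real \<times> real) set) \<times> cbox 0 1)
    (\<lambda>(p, t). (\<lambda>(s, a, b) t. integral {0..1} (\<lambda>u. t * f2 (a + t * (b + u * (s - b) - a)))) p t)"
    using integral_continuous_on_param[OF 1] by (simp add: case_prod_unfold continuous_on_subset[of UNIV])
  show ?thesis
    unfolding dd_def
    using continuous_on_minus[OF integral_continuous_on_param[OF 2]] by (simp add: case_prod_unfold)
qed

lemma dd_diag: "dd f2 x x x = - f2 x / 2"
  unfolding dd_def using ident_has_integral[of 0 "1::real"] by (simp add: has_integral_iff)

text \<open>\<open>E s\<close> is the first divided difference between \<open>a\<close> and
  \<open>s\<close>. Integrating \<open>f2\<close> over \<open>u\<close> gives a difference of values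
  of \<open>f1\<close>, whose integral over \<open>t\<close> is \<open>E s - E b\<close>; and
  \<open>E b = 0\<close> because \<open>f a = f b\<close>.\<close>

lemma dd_eq:
  assumes f: "\<And>x. (f has_real_derivative f1 x) (at x)" and f1: "\<And>x. (f1 has_real_derivative f2 x) (at x)"
    and f2: "continuous_on UNIV f2" and eq: "f a = f b" and "a \<noteq> b"
  shows "(s - a) * (b - s) * dd f2 s a b = f s - f a"
proof -
  define E where "E s = integral {0..1} (\<lambda>t. f1 (a + t * (s - a)))" for s
  have cf1: "continuous_on S (\<lambda>x. f1 (k x))" if "continuous_on S k" for S and k :: "real \<Rightarrow> real"
    using continuous_on_compose2[OF DERIV_continuous_on that, of UNIV f1 f2] f1
    by (simp add: DERIV_subset)
  have E: "(s - a) * E s = f s - f a" for s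
  proof -
    have "((\<lambda>t. (s - a) * f1 (a + t * (s - a))) has_integral f (a + 1 * (s - a)) - f (a + 0 * (s - a))) {0..1}"
    proof (rule fundamental_theorem_of_calculus)
      fix t :: real
      have "((\<lambda>t. f (a + t * (s - a))) has_real_derivative f1 (a + t * (s - a)) * (s - a)) (at t within {0..1})"
        by (rule DERIV_chain2[OF f]) (auto intro!: derivative_eq_intros)
      then show "((\<lambda>t. f (a + t * (s - a))) has_vector_derivative (s - a) * f1 (a + t * (s - a))) (at t within {0..1})"
        by (simp add: has_real_derivative_iff_has_vector_derivative mult.commute)
    qed simp
    then show ?thesis by (simp add: E_def has_integral_iff)
  qed
  have "(s - b) * integral {0..1} (\<lambda>u. t * f2 (a + t * (b + u * (s - b) - a))) =
      f1 (a + t * (s - a)) - f1 (a + t * (b - a))" for t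
  proof -
    have "((\<lambda>u. (s - b) * (t * f2 (a + t * (b + u * (s - b) - a)))) has_integral
        f1 (a + t * (b + 1 * (s - b) - a)) - f1 (a + t * (b + 0 * (s - b) - a))) {0..1}"
    proof (rule fundamental_theorem_of_calculus)
      fix u :: real
      have "((\<lambda>u. f1 (a + t * (b + u * (s - b) - a))) has_real_derivative
          f2 (a + t * (b + u * (s - b) - a)) * (t * (s - b))) (at u within {0..1})"
        by (rule DERIV_chain2[OF f1]) (auto intro!: derivative_eq_intros)
      then show "((\<lambda>u. f1 (a + t * (b + u * (s - b) - a))) has_vector_derivative
          (s - b) * (t * f2 (a + t * (b + u * (s - b) - a)))) (at u within {0..1})"
        by (simp add: has_real_derivative_iff_has_vector_derivative mult_ac)
    qed simp
    then show ?thesis by (simp add: has_integral_iff)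
  qed
  moreover have "(b - s) * - X = (s - b) * X" for X :: real by (simp add: algebra_simps)
  ultimately have "(b - s) * dd f2 s a b = integral {0..1} (\<lambda>t. f1 (a + t * (s - a)) - f1 (a + t * (b - a)))"
    unfolding dd_def by (simp only: flip: integral_mult_right)
  also have "\<dots> = E s - E b"
    unfolding E_def by (intro integral_diff integrable_continuous_real cf1 continuous_intros)
  finally have "(s - a) * ((b - s) * dd f2 s a b) = (s - a) * (E s - E b)" by simp
  moreover have "E b = 0" using E[of b] eq \<open>a \<noteq> b\<close> by simp
  ultimately show ?thesis using E[of s] by (simp add: mult.assoc)
qed

text \<open>Caratheodory's form of the derivative: in the factorization of \<open>dd_eq\<close> the
  factor beside \<open>s - a\<close> or \<open>s - b\<close> is continuous, so its value at the node
  is the derivative there.\<close>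

lemma dd_endpoints:
  assumes f: "\<And>x. (f has_real_derivative f1 x) (at x)" and f1: "\<And>x. (f1 has_real_derivative f2 x) (at x)"
    and f2: "continuous_on UNIV f2" and eq: "f a = f b" and "a \<noteq> b"
  shows "(b - a) * dd f2 a a b = f1 a" "(b - a) * dd f2 b a b = - f1 b"
proof -
  have c: "isCont (\<lambda>s. dd f2 s a b) x" for x
    using continuous_on_compose2[OF continuous_dd[OF f2], of UNIV "\<lambda>s. (s, a, b)"]
    by (auto simp: continuous_on_eq_continuous_at intro!: continuous_intros)
  have "(f has_real_derivative (b - a) * dd f2 a a b) (at a)"
    unfolding CARAT_DERIV using dd_eq[OF assms]
    by (intro exI[of _ "\<lambda>s. (b - s) * dd f2 s a b"]) (auto intro!: continuous_intros c simp: algebra_simps)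
  then show "(b - a) * dd f2 a a b = f1 a" using f DERIV_unique by blast
  have "(f has_real_derivative - ((b - a) * dd f2 b a b)) (at b)"
    unfolding CARAT_DERIV using dd_eq[OF assms] eq
    by (intro exI[of _ "\<lambda>s. - ((s - a) * dd f2 s a b)"]) (auto intro!: continuous_intros c simp: algebra_simps)
  then show "(b - a) * dd f2 b a b = - f1 b" using f DERIV_unique by fastforce
qed

section \<open>The turning points\<close>

locale delaunay =
  fixes m :: nat and h :: real
  assumes h: "0 < h"
begin

abbreviation L where "L \<equiv> L_fun (m + 3)"
abbreviation R where "R \<equiv> R_fun (m + 3) h"
definition g where "g s = L s - h / (real m + 2) * sin s ^ (m + 2)"
definition g1 where "g1 s = L_deriv m s - h * L s"
text \<open>For \<open>m = 0\<close> the truncated exponent \<open>m - 1\<close> does no harm, as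
  its term carries the factor \<open>real m\<close>.\<close>

definition g2 where "g2 s = - (real m + 2) * sin s ^ (m + 1) * cos s
    + (real m + 1) * (real m * sin s ^ (m - 1) * cos s ^ 3 - 2 * sin s ^ (m + 1) * cos s) - h * L_deriv m s"
abbreviation sc where "sc \<equiv> s_crit (m + 3) h"

text \<open>The parameter \<open>C\<close> enters only as a level, so the turning points for all
  \<open>C\<close> come from the one function \<open>g\<close>.\<close>

lemma L_minus_R: "L s - R C s = g s - C"
  by (simp add: g_def R_fun_add3)

lemma DERIV_g: "(g has_real_derivative g1 s) (at s)"
proof -
  have "g = (\<lambda>s. L s - R 0 s)" by (simp add: fun_eq_iff L_minus_R)
  then show ?thesis unfolding g1_def
    by (auto intro!: derivative_eq_intros DERIV_L_fun DERIV_R_fun)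
qed

lemma DERIV_L_deriv: "(L_deriv m has_real_derivative - (real m + 2) * sin s ^ (m + 1) * cos s
    + (real m + 1) * (real m * sin s ^ (m - 1) * cos s ^ 3 - 2 * sin s ^ (m + 1) * cos s)) (at s)"
proof -
  have "((\<lambda>s. - (sin s ^ (m + 2)) + (real m + 1) * ((cos s)\<^sup>2 * sin s ^ m)) has_real_derivative
    - (real (m + 2) * (cos s * sin s ^ (m + 2 - Suc 0))) +
    (real m + 1) * ((real 2 * (- sin s * cos s ^ (2 - Suc 0))) * sin s ^ m + real m * (cos s * sin s ^ (m - Suc 0)) * (cos s)\<^sup>2)) (at s)"
    by (intro DERIV_add DERIV_minus DERIV_cmult DERIV_mult DERIV_power DERIV_sin DERIV_cos)
  then show ?thesis
    unfolding L_deriv_def[abs_def] mult.assoc[of _ "(cos _)\<^sup>2"]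
    by (simp add: algebra_simps power2_eq_square power3_eq_cube)
qed

lemma DERIV_g1: "(g1 has_real_derivative g2 s) (at s)"
  unfolding g1_def[abs_def] g2_def
  by (intro DERIV_diff DERIV_cmult DERIV_L_deriv DERIV_L_fun)

lemma continuous_g2: "continuous_on UNIV g2"
  unfolding g2_def[abs_def] L_deriv_def by (intro continuous_intros)

lemma continuous_g: "continuous_on S g"
  by (meson DERIV_continuous_on DERIV_g DERIV_subset subset_UNIV)

text \<open>The sign of \<open>g1\<close> on the open interval: \<open>g1\<close> is the positive
  function \<open>L\<close> times \<open>\<kappa>\<close>, and \<open>\<kappa>\<close> is strictly
  decreasing with zero at \<open>sc\<close>.\<close>

definition \<kappa> where "\<kappa> s = - tan s + (real m + 1) * cot s - h"

lemma g1_eq: "0 < s \<Longrightarrow> s < pi / 2 \<Longrightarrow> g1 s = L s * \<kappa> s"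
proof -
  assume "0 < s" "s < pi / 2"
  then have "sin s \<noteq> 0" "cos s \<noteq> 0"
    using cos_gt_zero[of s] sin_gt_zero[of s] pi_gt_zero by linarith+
  then show "g1 s = L s * \<kappa> s"
    by (simp add: g1_def \<kappa>_def L_deriv_def L_fun_add3 tan_def cot_def field_simps power2_eq_square)
qed

lemma DERIV_\<kappa>:
  assumes "0 < s" "s < pi / 2"
  shows "(\<kappa> has_real_derivative - (inverse ((cos s)\<^sup>2)) - (real m + 1) * inverse ((sin s)\<^sup>2)) (at s)"
proof -
  have "sin s \<noteq> 0" "cos s \<noteq> 0"
    using assms cos_gt_zero[of s] sin_gt_zero[of s] by linarith+
  then show ?thesis
    unfolding \<kappa>_def[abs_def] by (auto intro!: derivative_eq_intros DERIV_cot DERIV_tan)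
qed

lemma \<kappa>_decreasing:
  assumes "0 < s" "s < s'" "s' < pi / 2"
  shows "\<kappa> s' < \<kappa> s"
proof (rule DERIV_neg_imp_decreasing[OF assms(2)])
  fix x assume "s \<le> x" "x \<le> s'"
  then have x: "0 < x" "x < pi / 2" using assms by auto
  have "0 < sin x" "0 < cos x" using x cos_gt_zero[of x] sin_gt_zero[of x] by linarith+
  then have "0 < inverse ((cos x)\<^sup>2)" "0 < (real m + 1) * inverse ((sin x)\<^sup>2)" by simp_all
  then have "- (inverse ((cos x)\<^sup>2)) - (real m + 1) * inverse ((sin x)\<^sup>2) < 0" by linarith
  then show "\<exists>y. (\<kappa> has_real_derivative y) (at x) \<and> y < 0"
    using DERIV_\<kappa>[OF x] by blast
qed

lemma s_crit: "0 < sc" "sc < pi / 2" "\<kappa> sc = 0"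
proof -
  define M where "M = real m + 1"
  \<comment> \<open>With \<open>x = cot s\<close> the equation for the critical point reads
    \<open>M * x - 1 / x = h\<close>; this is the positive root of the resulting quadratic.\<close>
  define x where "x = (h + sqrt (h\<^sup>2 + 4 * M)) / (2 * M)"
  have M: "0 < M" by (simp add: M_def)
  have x: "0 < x" using h M by (auto simp: x_def intro!: divide_pos_pos add_pos_nonneg)
  have sq: "(sqrt (h\<^sup>2 + 4 * M))\<^sup>2 = h\<^sup>2 + 4 * M" using M by simp
  have "2 * M * x = h + sqrt (h\<^sup>2 + 4 * M)" using M by (simp add: x_def)
  then have "(2 * M * x - h)\<^sup>2 = h\<^sup>2 + 4 * M" using sq by simp
  then have "4 * M * (M * x * x - h * x) = 4 * M * 1" by (simp add: power2_eq_square algebra_simps)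
  then have "M * x * x - h * x = 1" using M by (metis mult_cancel_left less_irrefl mult_eq_0_iff zero_neq_numeral)
  then have xe: "M * x - 1 / x = h" using x by (simp add: field_simps)
  define s where "s = arctan (1 / x)"
  have s: "0 < s" "s < pi / 2" using x arctan_ubound[of "1 / x"] by (auto simp: s_def)
  have ks: "\<kappa> s = 0"
    using xe x by (simp add: \<kappa>_def s_def M_def tan_arctan cot_altdef)
  have "sc = s"
    unfolding s_crit_def
  proof (rule the_equality)
    show "s \<in> {0<..<pi / 2} \<and> - tan s + (real (m + 3) - 2) * cot s = h"
      using s ks by (simp add: \<kappa>_def add.commute)
  next
    fix s' assume "s' \<in> {0<..<pi / 2} \<and> - tan s' + (real (m + 3) - 2) * cot s' = h"
    then have "0 < s'" "s' < pi / 2" "\<kappa> s' = 0" by (auto simp: \<kappa>_def)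
    then show "s' = s" using \<kappa>_decreasing[of s s'] \<kappa>_decreasing[of s' s] s ks
      by (cases s s' rule: linorder_cases) auto
  qed
  then show "0 < sc" "sc < pi / 2" "\<kappa> sc = 0" using s ks by auto
qed

lemma g1_pos: "0 < s \<Longrightarrow> s < sc \<Longrightarrow> 0 < g1 s"
  using g1_eq[of s] L_fun_pos[of s m] \<kappa>_decreasing[of s sc] s_crit by auto

lemma g1_neg: "sc < s \<Longrightarrow> s < pi / 2 \<Longrightarrow> g1 s < 0"
  using g1_eq[of s] L_fun_pos[of s m] \<kappa>_decreasing[of sc s] s_crit by (auto simp: mult_pos_neg)

lemma g_increasing: "0 \<le> s \<Longrightarrow> s < s' \<Longrightarrow> s' \<le> sc \<Longrightarrow> g s < g s'"
  by (rule DERIV_pos_imp_increasing_open) (auto intro!: continuous_g exI DERIV_g g1_pos)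

lemma g_decreasing: "sc \<le> s \<Longrightarrow> s < s' \<Longrightarrow> s' \<le> pi / 2 \<Longrightarrow> g s' < g s"
  by (rule DERIV_neg_imp_decreasing_open) (auto intro!: continuous_g exI DERIV_g g1_neg)

lemma g_0: "g 0 = 0" by (simp add: g_def L_fun_add3)
lemma g_pi_half: "g (pi / 2) < 0" using h by (simp add: g_def L_fun_add3)

lemma C_crit: "C_crit (m + 3) h = g sc"
proof -
  have "m + 3 - 1 = m + 2" "real (m + 3) - 1 = real m + 2" by simp_all
  then show ?thesis unfolding C_crit_def g_def by metis
qed

text \<open>Inverse branches of \<open>g\<close>. They agree with \<open>z_L\<close> and
  \<open>z_R\<close> for levels strictly between 0 and \<open>g sc\<close>, but make sense also at
  \<open>g sc\<close>, where both equal \<open>sc\<close> while the set defining \<open>z_L\<close>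
  and \<open>z_R\<close> is empty.\<close>

definition a where "a C = inv_into {0..sc} g C"
definition b where "b C = inv_into {sc..pi / 2} g C"

lemma a_in: assumes "0 \<le> C" "C \<le> g sc" shows "C \<in> g ` {0..sc}"
  using IVT'[of g 0 C sc] assms s_crit g_0 continuous_g by (auto simp: image_iff Bex_def)

lemma b_in: assumes "0 \<le> C" "C \<le> g sc" shows "C \<in> g ` {sc..pi / 2}"
  using IVT2'[of g "pi / 2" C sc] assms s_crit g_pi_half continuous_g by (auto simp: image_iff Bex_def)

lemma inj_a: "inj_on g {0..sc}"
  by (rule linorder_inj_onI) (use g_increasing in \<open>auto simp: less_imp_neq\<close>)

lemma inj_b: "inj_on g {sc..pi / 2}"
  by (rule linorder_inj_onI) (use g_decreasing in \<open>auto simp: less_imp_neq[symmetric] intro!: order.strict_implies_not_eq[symmetric]\<close>)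

lemma g_a: "0 \<le> C \<Longrightarrow> C \<le> g sc \<Longrightarrow> g (a C) = C"
  unfolding a_def by (rule f_inv_into_f[OF a_in])
lemma g_b: "0 \<le> C \<Longrightarrow> C \<le> g sc \<Longrightarrow> g (b C) = C"
  unfolding b_def by (rule f_inv_into_f[OF b_in])
lemma a_range: "0 \<le> C \<Longrightarrow> C \<le> g sc \<Longrightarrow> a C \<in> {0..sc}"
  unfolding a_def by (rule inv_into_into[OF a_in])
lemma b_range: "0 \<le> C \<Longrightarrow> C \<le> g sc \<Longrightarrow> b C \<in> {sc..pi / 2}"
  unfolding b_def by (rule inv_into_into[OF b_in])

lemma ab_bounds:
  assumes "0 < C" "C \<le> g sc"
  shows "0 < a C" "a C \<le> sc" "sc \<le> b C" "b C < pi / 2"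
proof -
  have "a C \<noteq> 0" using g_a[of C] g_0 assms by auto
  moreover have "b C \<noteq> pi / 2"
  proof
    assume "b C = pi / 2"
    then have "g (pi / 2) = C" using g_b[of C] assms by (metis less_imp_le)
    then show False using g_pi_half assms by simp
  qed
  ultimately show "0 < a C" "a C \<le> sc" "sc \<le> b C" "b C < pi / 2"
    using a_range[of C] b_range[of C] assms by auto
qed

lemma ab_strict:
  assumes "0 < C" "C < g sc"
  shows "a C < sc" "sc < b C"
proof -
  have "a C \<noteq> sc" "b C \<noteq> sc" using g_a[of C] g_b[of C] assms by auto
  then show "a C < sc" "sc < b C" using ab_bounds[of C] assms by auto
qed

lemma ab_crit: "a (g sc) = sc" "b (g sc) = sc"
  using s_crit by (auto simp: a_def b_def intro!: inv_into_f_f inj_a inj_b)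

text \<open>The inverse of a continuous injection of a compact interval is continuous.\<close>

lemma continuous_a: "continuous_on {0..g sc} a"
proof -
  have "continuous_on (g ` {0..sc}) a"
    unfolding a_def by (rule continuous_on_inv[OF continuous_g]) (auto simp: inj_a)
  then show ?thesis by (rule continuous_on_subset) (use a_in in auto)
qed

lemma continuous_b: "continuous_on {0..g sc} b"
proof -
  have "continuous_on (g ` {sc..pi / 2}) b"
    unfolding b_def by (rule continuous_on_inv[OF continuous_g]) (auto simp: inj_b)
  then show ?thesis by (rule continuous_on_subset) (use b_in in auto)
qed

lemma g_gt:
  assumes "0 < C" "C < g sc" "a C < s" "s < b C"
  shows "C < g s"
proof (cases "s \<le> sc")
  case True
  then show ?thesis using g_increasing[of "a C" s] g_a[of C] ab_bounds[of C] assms by auto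
next
  case False
  then show ?thesis using g_decreasing[of s "b C"] g_b[of C] ab_bounds[of C] assms by auto
qed

lemma g_le:
  assumes "0 < C" "C < g sc" "0 \<le> s" "s \<le> pi / 2" "\<not> (a C < s \<and> s < b C)"
  shows "g s \<le> C"
proof (cases "s \<le> a C")
  case True
  then show ?thesis using g_increasing[of s "a C"] g_a[of C] ab_bounds[of C] assms
    by (cases "s = a C") auto
next
  case False
  then show ?thesis using g_decreasing[of "b C" s] g_b[of C] ab_bounds[of C] assms
    by (cases "s = b C") auto
qed

lemma z_L_R:
  assumes "0 < C" "C < g sc"
  shows "z_L (m + 3) h C = a C" "z_R (m + 3) h C = b C"
proof -
  have *: "R C s < L s \<longleftrightarrow> C < g s" for s using L_minus_R[of s C] by linarith
  have "{s \<in> {0<..<pi / 2}. R C s < L s} = {a C<..<b C}"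
  proof (intro equalityI subsetI)
    fix s assume "s \<in> {s \<in> {0<..<pi / 2}. R C s < L s}"
    then have "0 < s" "s < pi / 2" "C < g s" by (auto simp: *)
    then show "s \<in> {a C<..<b C}" using g_le[OF assms, of s] by force
  next
    fix s assume "s \<in> {a C<..<b C}"
    then show "s \<in> {s \<in> {0<..<pi / 2}. R C s < L s}"
      using g_gt[OF assms, of s] ab_bounds[of C] assms by (auto simp: *)
  qed
  moreover have "a C < b C" using ab_strict[OF assms] by simp
  ultimately show "z_L (m + 3) h C = a C" "z_R (m + 3) h C = b C"
    by (simp_all add: z_L_def z_R_def)
qed

end

section \<open>Regularization of the period integral\<close>

context delaunay
begin

definition D where "D C s = dd g2 s (a C) (b C)"
text \<open>The integrand of \<open>s_1\<close> is
  \<open>P C s / sqrt ((s - a C) * (b C - s))\<close> inside the interval. Under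
  \<open>s = \<sigma> C \<phi>\<close> the root cancels against the derivative of
  \<open>\<sigma>\<close>, so \<open>P\<close> is what is left to integrate in
  \<open>\<phi>\<close>.\<close>

definition P where "P C s = R C s / (cos s * sqrt ((L s + R C s) * D C s))"
definition \<sigma> where "\<sigma> C \<phi> = (a C + b C) / 2 + (b C - a C) / 2 * sin \<phi>"

lemma D_eq:
  assumes "0 < C" "C < g sc"
  shows "(s - a C) * (b C - s) * D C s = g s - C"
  using dd_eq[OF DERIV_g DERIV_g1 continuous_g2, of "a C" "b C" s] g_a[of C] g_b[of C]
    ab_strict[OF assms] assms by (simp add: D_def)

text \<open>Since \<open>\<kappa>\<close> vanishes at \<open>sc\<close>, differentiating
  \<open>g1 = L * \<kappa>\<close> leaves only \<open>L\<close> times the derivative of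
  \<open>\<kappa>\<close>.\<close>

lemma g2_crit: "g2 sc = - L sc * (inverse ((cos sc)\<^sup>2) + (real m + 1) * inverse ((sin sc)\<^sup>2))"
proof -
  have "((\<lambda>s. L s * \<kappa> s) has_real_derivative L_deriv m sc * \<kappa> sc +
      (- (inverse ((cos sc)\<^sup>2)) - (real m + 1) * inverse ((sin sc)\<^sup>2)) * L sc) (at sc)"
    by (intro DERIV_mult DERIV_L_fun DERIV_\<kappa> s_crit)
  then have "(g1 has_real_derivative L_deriv m sc * \<kappa> sc +
      (- (inverse ((cos sc)\<^sup>2)) - (real m + 1) * inverse ((sin sc)\<^sup>2)) * L sc) (at sc)"
    by (rule has_field_derivative_transform_within_open[of _ _ _ "{0<..<pi / 2}"])
      (use s_crit g1_eq in auto)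
  from DERIV_unique[OF DERIV_g1 this] show ?thesis
    by (simp add: s_crit algebra_simps)
qed

lemma g2_crit_neg: "g2 sc < 0"
proof -
  have "sin sc > 0" "cos sc > 0" using s_crit sin_gt_zero[of sc] cos_gt_zero[of sc] by linarith+
  then have "0 < inverse ((cos sc)\<^sup>2)" "0 < (real m + 1) * inverse ((sin sc)\<^sup>2)" by simp_all
  then have "0 < inverse ((cos sc)\<^sup>2) + (real m + 1) * inverse ((sin sc)\<^sup>2)" by linarith
  then show ?thesis unfolding g2_crit using L_fun_pos[of sc m] s_crit by (simp add: mult_neg_pos)
qed

text \<open>Three reasons in turn: in the degenerate case the value is \<open>- g2 sc / 2\<close>;
  at the turning points it has the sign given by the slope of \<open>g\<close>; strictly between
  them \<open>g\<close> exceeds \<open>C\<close>.\<close>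

lemma D_pos:
  assumes C: "0 < C" "C \<le> g sc" and s: "s \<in> {a C..b C}"
  shows "0 < D C s"
proof (cases "C = g sc")
  case True
  then have "s = sc" using s by (simp add: ab_crit)
  then show ?thesis using True g2_crit_neg by (simp add: D_def ab_crit dd_diag)
next
  case False
  then have C': "C < g sc" using C by simp
  note ab = ab_strict[OF C(1) C'] ab_bounds[OF C]
  have ge: "g (a C) = g (b C)" using g_a[of C] g_b[of C] C by simp
  have ne: "a C \<noteq> b C" using ab by simp
  note ends = dd_endpoints[OF DERIV_g DERIV_g1 continuous_g2 ge ne]
  consider "s = a C" | "s = b C" | "a C < s" "s < b C" using s by force
  then show ?thesis
  proof cases
    case 1
    have "0 < (b C - a C) * D C s" using ends(1) g1_pos[of "a C"] ab by (simp add: 1 D_def)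
    then show ?thesis using ab by (simp add: zero_less_mult_iff)
  next
    case 2
    have "0 < (b C - a C) * D C s" using ends(2) g1_neg[of "b C"] ab by (simp add: 2 D_def)
    then show ?thesis using ab by (simp add: zero_less_mult_iff)
  next
    case 3
    then have "0 < (s - a C) * (b C - s) * D C s"
      unfolding D_eq[OF C(1) C'] using g_gt[OF C(1) C'] by simp
    then show ?thesis by (rule zero_less_mult_pos) (use 3 in simp)
  qed
qed

lemma pos_between:
  assumes C: "0 < C" "C \<le> g sc" and s: "s \<in> {a C..b C}"
  shows "0 < s" "s < pi / 2" "0 < sin s" "0 < cos s" "0 < L s" "0 < R C s" "0 < (L s + R C s) * D C s"
proof -
  show s': "0 < s" "s < pi / 2" using s ab_bounds[OF C] by auto
  then show "0 < sin s" "0 < cos s" using sin_gt_zero[of s] cos_gt_zero[of s] by linarith+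
  show L: "0 < L s" by (rule L_fun_pos[OF s'])
  show R: "0 < R C s" using s' C h by (intro R_fun_pos) auto
  show "0 < (L s + R C s) * D C s" using D_pos[OF assms] L R by simp
qed

lemma P_pos: "0 < C \<Longrightarrow> C \<le> g sc \<Longrightarrow> s \<in> {a C..b C} \<Longrightarrow> 0 < P C s"
  using pos_between[of C s] by (simp add: P_def)

lemma \<sigma>_range: "0 < C \<Longrightarrow> C \<le> g sc \<Longrightarrow> \<sigma> C \<phi> \<in> {a C..b C}"
proof -
  assume "0 < C" "C \<le> g sc"
  then have "a C \<le> b C" using ab_bounds[of C] by simp
  moreover have "0 \<le> 1 + sin \<phi>" "0 \<le> 1 - sin \<phi>"
    using sin_ge_minus_one[of \<phi>] sin_le_one[of \<phi>] by linarith+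
  ultimately have "0 \<le> (b C - a C) / 2 * (1 + sin \<phi>)" "0 \<le> (b C - a C) / 2 * (1 - sin \<phi>)"
    by (simp_all del: diff_ge_0_iff_ge)
  then show ?thesis unfolding \<sigma>_def by (simp add: algebra_simps add_divide_distrib diff_divide_distrib)
qed

lemma continuous_P:
  assumes k: "continuous_on S k" and C: "continuous_on S C"
    and SC: "\<And>x. x \<in> S \<Longrightarrow> 0 < C x \<and> C x \<le> g sc \<and> k x \<in> {a (C x)..b (C x)}"
  shows "continuous_on S (\<lambda>x. P (C x) (k x))"
proof -
  have "C ` S \<subseteq> {0..g sc}" using SC by force
  then have ca: "continuous_on S (\<lambda>x. a (C x))" "continuous_on S (\<lambda>x. b (C x))"
    by (rule continuous_on_compose2[OF continuous_a C] continuous_on_compose2[OF continuous_b C])+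
  have cD: "continuous_on S (\<lambda>x. D (C x) (k x))"
    using continuous_on_compose2[OF continuous_dd[OF continuous_g2] continuous_on_Pair[OF k continuous_on_Pair[OF ca]]]
    by (simp add: D_def)
  have sin: "continuous_on S (\<lambda>x. sin (k x))" and cos: "continuous_on S (\<lambda>x. cos (k x))"
    by (rule continuous_on_compose2[OF _ k subset_UNIV], intro continuous_intros)+
  have cR: "continuous_on S (\<lambda>x. R (C x) (k x))" and cL: "continuous_on S (\<lambda>x. L (k x))"
    unfolding R_fun_add3 L_fun_add3 by (intro continuous_intros k C sin cos)+
  show ?thesis
    unfolding P_def
  proof (intro continuous_intros cR cL cD cos ballI)
    fix x assume "x \<in> S"
    then show "cos (k x) * sqrt ((L (k x) + R (C x) (k x)) * D (C x) (k x)) \<noteq> 0"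
      using SC[of x] pos_between[of "C x" "k x"] by auto
  qed
qed

lemma continuous_\<sigma>:
  assumes k: "continuous_on S k" and C: "continuous_on S C"
    and SC: "\<And>x. x \<in> S \<Longrightarrow> 0 < C x \<and> C x \<le> g sc"
  shows "continuous_on S (\<lambda>x. \<sigma> (C x) (k x))"
proof -
  have "C ` S \<subseteq> {0..g sc}" using SC by force
  then have ca: "continuous_on S (\<lambda>x. a (C x))" "continuous_on S (\<lambda>x. b (C x))"
    by (rule continuous_on_compose2[OF continuous_a C] continuous_on_compose2[OF continuous_b C])+
  have "continuous_on S (\<lambda>x. sin (k x))"
    by (rule continuous_on_compose2[OF _ k subset_UNIV]) (intro continuous_intros)
  then show ?thesis unfolding \<sigma>_def by (intro continuous_intros ca) auto
qed

lemma continuous_P\<sigma>: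
  assumes k: "continuous_on S k" and C: "continuous_on S C"
    and SC: "\<And>x. x \<in> S \<Longrightarrow> 0 < C x \<and> C x \<le> g sc"
  shows "continuous_on S (\<lambda>x. P (C x) (\<sigma> (C x) (k x)))"
  using SC by (intro continuous_P continuous_\<sigma> k C) (auto intro: \<sigma>_range simp del: atLeastAtMost_iff)

definition T where "T C = integral {- (pi / 2)..pi / 2} (\<lambda>\<phi>. P C (\<sigma> C \<phi>))"

lemma continuous_T: "continuous_on {0<..g sc} T"
proof -
  have "continuous_on ({0<..g sc} \<times> cbox (- (pi / 2)) (pi / 2)) (\<lambda>(C, \<phi>). P C (\<sigma> C \<phi>))"
    unfolding case_prod_unfold by (rule continuous_P\<sigma>) (auto intro!: continuous_intros)
  from integral_continuous_on_param[OF this] show ?thesis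
    by (simp add: T_def[abs_def])
qed

text \<open>At the critical level \<open>\<sigma>\<close> is constant, so the integral is
  \<open>pi\<close> times \<open>P (g sc) sc\<close>.\<close>

lemma T_crit: "T (g sc) = pi / sqrt (1 + (real m + 1) * (cot sc)\<^sup>2)"
proof -
  have pos: "0 < sin sc" "0 < cos sc" "0 < L sc"
    using s_crit sin_gt_zero[of sc] cos_gt_zero[of sc] L_fun_pos[of sc m] by linarith+
  have RL: "R (g sc) sc = L sc" using L_minus_R[of sc "g sc"] by simp
  have "(L sc + L sc) * D (g sc) sc = (L sc)\<^sup>2 * (inverse ((cos sc)\<^sup>2) + (real m + 1) * inverse ((sin sc)\<^sup>2))"
    by (simp add: D_def ab_crit dd_diag g2_crit power2_eq_square)
  then have "P (g sc) sc = 1 / (cos sc * sqrt (inverse ((cos sc)\<^sup>2) + (real m + 1) * inverse ((sin sc)\<^sup>2)))"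
    using pos by (simp add: P_def RL real_sqrt_mult)
  also have "cos sc * sqrt (inverse ((cos sc)\<^sup>2) + (real m + 1) * inverse ((sin sc)\<^sup>2)) =
      sqrt ((cos sc)\<^sup>2 * (inverse ((cos sc)\<^sup>2) + (real m + 1) * inverse ((sin sc)\<^sup>2)))"
    using pos by (simp add: real_sqrt_mult)
  also have "(cos sc)\<^sup>2 * (inverse ((cos sc)\<^sup>2) + (real m + 1) * inverse ((sin sc)\<^sup>2)) =
      1 + (real m + 1) * (cot sc)\<^sup>2"
    using pos by (simp add: cot_def field_simps)
  finally show ?thesis
    by (simp add: T_def \<sigma>_def ab_crit)
qed

end

section \<open>The oscillation parametrized by its phase\<close>

locale delaunay_oscillation = delaunay +
  fixes C :: real
  assumes C: "0 < C" "C < g sc"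
begin

lemma C': "C \<le> g sc" using C by simp

text \<open>Time as a function of the phase on the whole line. Time 0 is put at the phase
  \<open>- (pi / 2)\<close>, where the oscillation is at its minimum \<open>a C\<close>.\<close>

definition \<Theta> where
  "\<Theta> = (SOME F. (\<forall>x. (F has_real_derivative P C (\<sigma> C x)) (at x)) \<and> F (- (pi / 2)) = 0)"

lemma \<Theta>: "(\<Theta> has_real_derivative P C (\<sigma> C x)) (at x)" "\<Theta> (- (pi / 2)) = 0"
proof -
  have "isCont (\<lambda>x. P C (\<sigma> C x)) x" for x
    using continuous_P\<sigma>[of UNIV "\<lambda>x. x" "\<lambda>_. C"] C by (auto simp: continuous_on_eq_continuous_at)
  then have "\<exists>F. \<forall>x::real. -\<infinity> < ereal x \<longrightarrow> ereal x < \<infinity> \<longrightarrow> (F has_vector_derivative P C (\<sigma> C x)) (at x)"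
    by (intro einterval_antiderivative) auto
  then obtain F where F: "\<And>x. (F has_real_derivative P C (\<sigma> C x)) (at x)"
    by (auto simp: has_real_derivative_iff_has_vector_derivative)
  then have "((\<lambda>x. F x - F (- (pi / 2))) has_real_derivative P C (\<sigma> C x)) (at x)" for x
    by (auto intro!: derivative_eq_intros)
  then have "\<exists>F. (\<forall>x. (F has_real_derivative P C (\<sigma> C x)) (at x)) \<and> F (- (pi / 2)) = 0"
    by (intro exI[of _ "\<lambda>x. F x - F (- (pi / 2))"]) auto
  from someI_ex[OF this] show "(\<Theta> has_real_derivative P C (\<sigma> C x)) (at x)" "\<Theta> (- (pi / 2)) = 0"
    unfolding \<Theta>_def by blast+
qed

lemma P\<sigma>_pos: "0 < P C (\<sigma> C x)"
  by (intro P_pos C C' \<sigma>_range)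

lemma continuous_\<Theta>: "continuous_on S \<Theta>"
  by (rule DERIV_continuous_on) (rule has_field_derivative_at_within[OF \<Theta>(1)])

lemma strict_mono_\<Theta>: "x < y \<Longrightarrow> \<Theta> x < \<Theta> y"
  by (rule DERIV_pos_imp_increasing) (use \<Theta>(1) P\<sigma>_pos in blast)+

lemma \<Theta>_less_iff [simp]: "\<Theta> x < \<Theta> y \<longleftrightarrow> x < y" and \<Theta>_eq_iff [simp]: "\<Theta> x = \<Theta> y \<longleftrightarrow> x = y"
  using strict_mono_\<Theta>[of x y] strict_mono_\<Theta>[of y x] by (cases x y rule: linorder_cases; auto)+

lemma T_eq: "T C = \<Theta> (pi / 2)"
proof -
  have "((\<lambda>\<phi>. P C (\<sigma> C \<phi>)) has_integral \<Theta> (pi / 2) - \<Theta> (- (pi / 2))) {- (pi / 2)..pi / 2}"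
    by (rule fundamental_theorem_of_calculus)
      (auto simp flip: has_real_derivative_iff_has_vector_derivative intro: has_field_derivative_at_within \<Theta>(1))
  then show ?thesis by (simp add: T_def has_integral_iff \<Theta>(2))
qed

lemma T_pos: "0 < T C"
  using strict_mono_\<Theta>[of "- (pi / 2)" "pi / 2"] by (simp add: T_eq \<Theta>(2))

lemma \<sigma>_reflect: "\<sigma> C (- pi - x) = \<sigma> C x"
  by (simp add: \<sigma>_def sin_diff)

lemma \<sigma>_periodic: "\<sigma> C (x + 2 * pi * of_int j) = \<sigma> C x"
  using sin.plus_of_int[of x j] by (simp add: \<sigma>_def mult_ac)

text \<open>The reflection about \<open>- (pi / 2)\<close> preserves \<open>\<sigma>\<close>, so
  \<open>\<Theta> (- pi - x) + \<Theta> x\<close> is constant; it vanishes at the fixed point. This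
  is the evenness of the motion in time.\<close>

lemma \<Theta>_reflect: "\<Theta> (- pi - x) = - \<Theta> x"
proof -
  have "((\<lambda>x. \<Theta> (- pi - x) + \<Theta> x) has_real_derivative P C (\<sigma> C (- pi - x)) * (- 1) + P C (\<sigma> C x)) (at x)" for x
    by (intro DERIV_add \<Theta> DERIV_chain2[OF \<Theta>(1)]) (auto intro!: derivative_eq_intros)
  then have "\<forall>x. ((\<lambda>x. \<Theta> (- pi - x) + \<Theta> x) has_real_derivative 0) (at x)"
    by (simp add: \<sigma>_reflect)
  from DERIV_isconst_all[OF this, of x "- (pi / 2)"] show ?thesis
    using \<Theta>(2) by simp
qed

lemma \<Theta>_shift: "\<Theta> (x + 2 * pi) = \<Theta> x + 2 * T C"
proof -
  have "((\<lambda>x. \<Theta> (x + 2 * pi) - \<Theta> x) has_real_derivative P C (\<sigma> C (x + 2 * pi)) * 1 - P C (\<sigma> C x)) (at x)" for x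
    by (intro DERIV_diff \<Theta> DERIV_chain2[OF \<Theta>(1)]) (auto intro!: derivative_eq_intros)
  then have "\<forall>x. ((\<lambda>x. \<Theta> (x + 2 * pi) - \<Theta> x) has_real_derivative 0) (at x)"
    using \<sigma>_periodic[of _ 1] by simp
  \<comment> \<open>The constant is evaluated at \<open>- pi - pi / 2\<close>: the shift carries it
    to \<open>pi / 2\<close>, and the reflection relates the two values.\<close>
  from DERIV_isconst_all[OF this, of x "- pi - pi / 2"] show ?thesis
    using \<Theta>_reflect[of "pi / 2"] by (simp add: T_eq)
qed

lemma \<Theta>_shift_int: "\<Theta> (x + 2 * pi * of_int j) = \<Theta> x + 2 * T C * of_int j"
proof (induction j rule: int_induct[where k = 0])
  case (step1 i)
  then show ?case using \<Theta>_shift[of "x + 2 * pi * of_int i"] by (simp add: algebra_simps)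
next
  case (step2 i)
  then show ?case using \<Theta>_shift[of "x + 2 * pi * of_int (i - 1)"] by (simp add: algebra_simps)
qed simp

text \<open>Each full turn of the phase adds \<open>2 * T C > 0\<close>, so \<open>\<Theta>\<close>
  is unbounded in both directions, and the intermediate value theorem applies.\<close>

lemma surj_\<Theta>: "surj \<Theta>"
proof -
  have "\<exists>x. \<Theta> x = t" for t
  proof -
    obtain i :: int where i: "t / (2 * T C) \<le> of_int i" by (meson le_of_int_ceiling)
    obtain j :: int where j: "of_int j \<le> t / (2 * T C)" by (meson of_int_floor_le)
    have 1: "\<Theta> (- (pi / 2) + 2 * pi * of_int j) \<le> t" "t \<le> \<Theta> (- (pi / 2) + 2 * pi * of_int i)"
      unfolding \<Theta>_shift_int using i j T_pos by (auto simp: \<Theta>(2) field_simps)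
    then have "\<not> \<Theta> (- (pi / 2) + 2 * pi * of_int i) < \<Theta> (- (pi / 2) + 2 * pi * of_int j)" by linarith
    then have "- (pi / 2) + 2 * pi * of_int j \<le> - (pi / 2) + 2 * pi * of_int i" by simp
    from IVT'[OF 1 this continuous_\<Theta>] show ?thesis by blast
  qed
  then show ?thesis by (metis surjI)
qed

definition \<psi> where "\<psi> = inv \<Theta>"

lemma \<Theta>_\<psi> [simp]: "\<Theta> (\<psi> t) = t" unfolding \<psi>_def by (rule surj_f_inv_f[OF surj_\<Theta>])
lemma \<psi>_\<Theta> [simp]: "\<psi> (\<Theta> x) = x" unfolding \<psi>_def by (rule inv_f_f) (auto simp: inj_def)

lemma isCont_\<psi>: "isCont \<psi> t"
proof -
  have "isCont \<psi> (\<Theta> (\<psi> t))"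
    by (rule isCont_inverse_function[of 1])
      (use continuous_\<Theta>[of UNIV] in \<open>auto simp: continuous_on_eq_continuous_at\<close>)
  then show ?thesis by simp
qed

lemma DERIV_\<psi>: "(\<psi> has_real_derivative inverse (P C (\<sigma> C (\<psi> t)))) (at t)"
  by (rule DERIV_inverse_function[OF \<Theta>(1) _ _ _ _ isCont_\<psi>, of _ "t - 1" "t + 1"])
    (use P\<sigma>_pos[of "\<psi> t"] in auto)

definition r where "r t = \<sigma> C (\<psi> t)"
definition v where "v t = (b C - a C) / 2 * cos (\<psi> t) / P C (r t)"

lemma r_range: "r t \<in> {a C..b C}" unfolding r_def by (intro \<sigma>_range C C')

lemma DERIV_r: "(r has_real_derivative v t) (at t)"
proof -
  have "((\<lambda>t. (a C + b C) / 2 + (b C - a C) / 2 * sin (\<psi> t)) has_real_derivative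
      0 + (b C - a C) / 2 * (cos (\<psi> t) * inverse (P C (\<sigma> C (\<psi> t))))) (at t)"
    by (intro DERIV_add DERIV_const DERIV_cmult DERIV_chain2[OF DERIV_sin DERIV_\<psi>])
  moreover have "r = (\<lambda>t. (a C + b C) / 2 + (b C - a C) / 2 * sin (\<psi> t))"
    unfolding r_def \<sigma>_def ..
  moreover have "v t = 0 + (b C - a C) / 2 * (cos (\<psi> t) * inverse (P C (\<sigma> C (\<psi> t))))"
    unfolding v_def r_def divide_inverse[of _ "P _ _"] by (simp only: mult.assoc add_0)
  ultimately show ?thesis by (simp only:)
qed

lemma isCont_r: "isCont r t" using DERIV_r DERIV_isCont by blast

lemma isCont_v: "isCont v t"
proof -
  have "continuous_on UNIV (\<lambda>x. P C (r x))"
    using isCont_r r_range C by (intro continuous_P) (auto simp: continuous_at_imp_continuous_on simp del: atLeastAtMost_iff)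
  moreover have "continuous_on UNIV \<psi>" using isCont_\<psi> by (simp add: continuous_at_imp_continuous_on)
  ultimately have "continuous_on UNIV v"
    unfolding v_def[abs_def] by (intro continuous_intros) (use P\<sigma>_pos in \<open>auto simp: r_def less_imp_neq[symmetric] intro!: order.strict_implies_not_eq[symmetric]\<close>)
  then show ?thesis by (simp add: continuous_on_eq_continuous_at)
qed

text \<open>By the choice of \<open>\<sigma>\<close>, the square of
  \<open>(b C - a C) / 2 * cos (\<psi> t)\<close> is \<open>(r t - a C) * (b C - r t)\<close>;
  multiplied by \<open>D\<close> this becomes \<open>L - R\<close>, and the factor
  \<open>L + R\<close> in \<open>P\<close> completes \<open>L\<^sup>2 - R\<^sup>2\<close>.\<close>

lemma energy_v: "(v t)\<^sup>2 = energy m h C (r t)"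
proof -
  note p = pos_between[OF C(1) C' r_range[of t]]
  let ?X = "(L (r t) + R C (r t)) * D C (r t)"
  have *: "(k * c)\<^sup>2 = (k * (1 + x)) * (k * (1 - x))" if "c\<^sup>2 = 1 - x\<^sup>2" for k c x :: real
    using that by (simp add: power_mult_distrib) (simp add: algebra_simps power2_eq_square)
  have "r t - a C = (b C - a C) / 2 * (1 + sin (\<psi> t))" "b C - r t = (b C - a C) / 2 * (1 - sin (\<psi> t))"
    by (simp_all add: r_def \<sigma>_def field_simps)
  then have "((b C - a C) / 2 * cos (\<psi> t))\<^sup>2 = (r t - a C) * (b C - r t)"
    by (simp only: *[OF cos_squared_eq])
  then have "(v t)\<^sup>2 = (r t - a C) * (b C - r t) / (P C (r t))\<^sup>2"
    by (simp add: v_def power_divide)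
  also have "(P C (r t))\<^sup>2 = (R C (r t))\<^sup>2 / ((cos (r t))\<^sup>2 * ?X)"
    using p by (simp add: P_def power_divide power_mult_distrib)
  also have "(r t - a C) * (b C - r t) / ((R C (r t))\<^sup>2 / ((cos (r t))\<^sup>2 * ?X)) =
      (cos (r t))\<^sup>2 * (L (r t) + R C (r t)) * ((r t - a C) * (b C - r t) * D C (r t)) / (R C (r t))\<^sup>2"
    by simp
  also have "(r t - a C) * (b C - r t) * D C (r t) = L (r t) - R C (r t)"
    unfolding D_eq[OF C] L_minus_R ..
  finally show ?thesis
    using p by (simp add: energy_def field_simps power2_eq_square)
qed

text \<open>Where \<open>v\<close> does not vanish its sign \<open>e\<close> is locally constant, so
  \<open>v\<close> is \<open>e\<close> times the root of the energy nearby, and the chain rule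
  applies.\<close>

lemma DERIV_v_nonzero:
  assumes "v t \<noteq> 0"
  shows "(v has_real_derivative accel m h C (r t)) (at t)"
proof -
  define e where "e = sgn (v t)"
  have e: "e * e = 1" "v t = e * \<bar>v t\<bar>" using assms by (auto simp: e_def sgn_if)
  have "eventually (\<lambda>s. 0 < e * v s) (at t)"
  proof (rule order_tendstoD)
    show "((\<lambda>s. e * v s) \<longlongrightarrow> e * v t) (at t)" using isCont_v[of t] by (intro tendsto_intros) (simp add: isCont_def)
    show "0 < e * v t" using assms by (auto simp: e_def sgn_if)
  qed
  then have "eventually (\<lambda>s. v s = e * sqrt (energy m h C (r s))) (at t)"
  proof eventually_elim
    case (elim s)
    have "sqrt (energy m h C (r s)) = \<bar>v s\<bar>" by (simp flip: energy_v)
    then show ?case using elim e by (auto simp: e_def sgn_if split: if_splits)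
  qed
  moreover have "v t = e * sqrt (energy m h C (r t))" using e by (simp flip: energy_v)
  ultimately have ev: "eventually (\<lambda>s. v s = e * sqrt (energy m h C (r s))) (nhds t)"
    by (simp add: eventually_nhds_conv_at)
  have en: "0 < energy m h C (r t)" using assms by (simp flip: energy_v)
  have "R C (r t) \<noteq> 0" using pos_between[OF C(1) C' r_range[of t]] by simp
  from DERIV_chain2[OF DERIV_energy[OF this] DERIV_r]
  have "((\<lambda>t. energy m h C (r t)) has_real_derivative 2 * accel m h C (r t) * v t) (at t)" .
  from DERIV_cmult[OF DERIV_chain2[OF DERIV_real_sqrt[OF en] this], of e]
  have "((\<lambda>s. e * sqrt (energy m h C (r s))) has_real_derivative
      e * (inverse (sqrt (energy m h C (r t))) / 2 * (2 * accel m h C (r t) * v t))) (at t)" .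
  moreover have "e * (inverse (sqrt (energy m h C (r t))) / 2 * (2 * accel m h C (r t) * v t)) = accel m h C (r t)"
    using e assms by (simp add: flip: energy_v) (auto simp: field_simps e_def sgn_if)
  ultimately have "((\<lambda>s. e * sqrt (energy m h C (r s))) has_real_derivative accel m h C (r t)) (at t)"
    by (simp only:)
  then show ?thesis unfolding DERIV_cong_ev[OF refl ev refl] .
qed

text \<open>Turning points are isolated and the formula holds around them, so l'Hopital's rule
  applied to the difference quotient of \<open>v\<close> carries it over by continuity of
  \<open>accel\<close>.\<close>

lemma DERIV_v: "(v has_real_derivative accel m h C (r t)) (at t)"
proof (cases "v t = 0")
  case True
  have v0: "v s = 0 \<longleftrightarrow> cos (\<psi> s) = 0" for s
    using P\<sigma>_pos[of "\<psi> s"] ab_strict[OF C] by (auto simp: v_def r_def)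
  \<comment> \<open>Distinct zeros of the cosine are at least \<open>pi\<close> apart, so within
    this ball the only turning phase is \<open>\<psi> t\<close>.\<close>
  have "eventually (\<lambda>s. \<psi> s \<in> ball (\<psi> t) pi) (at t)"
    using isCont_\<psi>[of t] unfolding isCont_def by (rule topological_tendstoD) auto
  moreover have "eventually (\<lambda>s. s \<noteq> t) (at t)" by (simp add: eventually_at_filter)
  ultimately have ev: "eventually (\<lambda>s. (v has_real_derivative accel m h C (r s)) (at s)) (at t)"
  proof eventually_elim
    case (elim s)
    have "\<psi> s \<noteq> \<psi> t" using elim(2) by (metis \<Theta>_\<psi>)
    moreover have "\<bar>\<psi> s - \<psi> t\<bar> < pi" using elim(1) by (simp add: dist_real_def abs_minus_commute)
    ultimately have "sin (\<psi> s - \<psi> t) \<noteq> 0"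
      using sin_gt_zero[of "\<psi> s - \<psi> t"] sin_gt_zero[of "\<psi> t - \<psi> s"] sin_minus[of "\<psi> s - \<psi> t"]
      by (cases "\<psi> s < \<psi> t") auto
    then have "cos (\<psi> s) \<noteq> 0" using True v0[of t] by (auto simp: sin_diff)
    then show ?case using v0 by (intro DERIV_v_nonzero) simp
  qed
  have "isCont (accel m h C) (r t)"
  proof -
    have "R C (r t) \<noteq> 0" using pos_between[OF C(1) C' r_range[of t]] by simp
    then show ?thesis
      unfolding accel_def Let_def L_deriv_def
      by (intro continuous_intros DERIV_isCont[OF DERIV_L_fun] DERIV_isCont[OF DERIV_R_fun]) auto
  qed
  then have lim: "((\<lambda>s. accel m h C (r s)) \<longlongrightarrow> accel m h C (r t)) (at t)"
    by (rule isCont_tendsto_compose) (use isCont_r[of t] in \<open>simp add: isCont_def\<close>)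
  have "((\<lambda>s. v s / (s - t)) \<longlongrightarrow> accel m h C (r t)) (at t)"
  proof (rule lhopital[where g' = "\<lambda>_. 1" and f' = "\<lambda>s. accel m h C (r s)"])
    show "(v \<longlongrightarrow> 0) (at t)" using isCont_v[of t] True by (simp add: isCont_def)
    show "((\<lambda>s. s - t) \<longlongrightarrow> 0) (at t)" by (rule tendsto_eq_intros refl | simp)+
    show "eventually (\<lambda>s. s - t \<noteq> 0) (at t)" by (simp add: eventually_at_filter)
    show "eventually (\<lambda>s. ((\<lambda>s. s - t) has_real_derivative 1) (at s)) (at t)"
      by (auto intro!: always_eventually derivative_eq_intros)
  qed (use ev lim in auto)
  then show ?thesis using True by (simp add: has_field_derivative_iff)
qed (rule DERIV_v_nonzero)

sublocale motion: delaunay_motion m h C r v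
proof
  show "0 < r t" "r t < pi / 2" for t using pos_between[OF C(1) C' r_range[of t]] by auto
qed (use C h DERIV_r DERIV_v energy_v in auto)

section \<open>Identification with \<open>s_1\<close>, \<open>W\<close> and
  \<open>\<rho>\<close>\<close>

lemma s_1_\<sigma>:
  assumes "\<phi> \<in> {- (pi / 2)..pi / 2}"
  shows "s_1 (m + 3) h C (\<sigma> C \<phi>) = \<Theta> \<phi>"
    and "((\<lambda>s. R C s / (cos s * sqrt ((L s)\<^sup>2 - (R C s)\<^sup>2))) has_integral \<Theta> \<phi>) {a C..\<sigma> C \<phi>}"
proof -
  define k where "k = (b C - a C) / 2"
  have k: "0 < k" using ab_strict[OF C] by (simp add: k_def)
  define y where "y s = (s - (a C + b C) / 2) / k" for s
  have y\<sigma>: "y (\<sigma> C x) = sin x" for x using k by (simp add: y_def \<sigma>_def flip: k_def)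
  have \<sigma>y: "\<sigma> C (arcsin (y s)) = s" if "y s \<in> {-1..1}" for s
    using that k by (simp add: \<sigma>_def flip: k_def) (simp add: y_def)
  have y1: "1 + y s = (s - a C) / k" and y2: "1 - y s = (b C - s) / k" for s
    using k by (simp_all add: y_def k_def field_simps)
  have y_range: "y s \<in> {-1..1}" if "s \<in> {a C..b C}" for s
  proof -
    have "0 \<le> 1 + y s" "0 \<le> 1 - y s" unfolding y1 y2 using that k by auto
    then show ?thesis by auto
  qed
  have sub: "{a C..\<sigma> C \<phi>} \<subseteq> {a C..b C}" and le: "a C \<le> \<sigma> C \<phi>"
    using \<sigma>_range[OF C(1) C', of \<phi>] by auto
  \<comment> \<open>The substitution run backwards: \<open>\<Theta>\<close> after the inverse of
    \<open>\<sigma>\<close> is an antiderivative. It is differentiated only in the open interval and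
    merely continuous at the ends, so the singularities there do not matter.\<close>
  have "((\<lambda>s. R C s / (cos s * sqrt ((L s)\<^sup>2 - (R C s)\<^sup>2))) has_integral
      \<Theta> (arcsin (y (\<sigma> C \<phi>))) - \<Theta> (arcsin (y (a C)))) {a C..\<sigma> C \<phi>}"
  proof (rule fundamental_theorem_of_calculus_interior[OF le])
    have "continuous_on {a C..\<sigma> C \<phi>} y" unfolding y_def[abs_def] using k by (intro continuous_intros) auto
    then show "continuous_on {a C..\<sigma> C \<phi>} (\<lambda>s. \<Theta> (arcsin (y s)))"
      by (intro continuous_on_compose2[OF continuous_\<Theta>[of UNIV]] continuous_on_arcsin)
        (use sub y_range in \<open>auto simp del: \<Theta>_less_iff\<close>)
  next
    fix s assume s: "s \<in> {a C<..<\<sigma> C \<phi>}"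
    then have s': "a C < s" "s < b C" using \<sigma>_range[OF C(1) C', of \<phi>] by auto
    then have sI: "s \<in> {a C..b C}" by simp
    note p = pos_between[OF C(1) C' sI]
    have "0 < 1 + y s" "0 < 1 - y s" unfolding y1 y2 using s' k by auto
    then have ys: "-1 < y s" "y s < 1" by auto
    have "1 - (y s)\<^sup>2 = (1 + y s) * (1 - y s)" by (simp add: power2_eq_square algebra_simps)
    then have "sqrt (1 - (y s)\<^sup>2) = sqrt ((s - a C) * (b C - s)) / k"
      unfolding y1 y2 using k by (simp add: real_sqrt_divide real_sqrt_mult)
    moreover have "(arcsin has_real_derivative inverse (sqrt (1 - (y s)\<^sup>2))) (at (y s))"
      by (rule DERIV_arcsin[OF ys])
    moreover have "(y has_real_derivative 1 / k) (at s)"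
      unfolding y_def[abs_def] using k by (auto intro!: derivative_eq_intros)
    ultimately have as: "(arcsin has_real_derivative inverse (sqrt ((s - a C) * (b C - s)) / k)) (at (y s))"
      and y': "(y has_real_derivative 1 / k) (at s)" by simp_all
    have "((\<lambda>s. \<Theta> (arcsin (y s))) has_real_derivative
      P C (\<sigma> C (arcsin (y s))) * (inverse (sqrt ((s - a C) * (b C - s)) / k) * (1 / k))) (at s)"
      by (rule DERIV_chain2[OF \<Theta>(1) DERIV_chain2[OF as y']])
    moreover have "P C (\<sigma> C (arcsin (y s))) * (inverse (sqrt ((s - a C) * (b C - s)) / k) * (1 / k)) =
        P C s / sqrt ((s - a C) * (b C - s))"
      using k \<sigma>y[of s] ys by (simp add: divide_inverse)
    moreover have "P C s / sqrt ((s - a C) * (b C - s)) = R C s / (cos s * sqrt ((L s)\<^sup>2 - (R C s)\<^sup>2))"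
    proof -
      have "(L s)\<^sup>2 - (R C s)\<^sup>2 = (L s + R C s) * (L s - R C s)" by (simp add: power2_eq_square algebra_simps)
      also have "L s - R C s = (s - a C) * (b C - s) * D C s" unfolding D_eq[OF C] L_minus_R ..
      finally have "sqrt ((L s)\<^sup>2 - (R C s)\<^sup>2) = sqrt ((L s + R C s) * D C s) * sqrt ((s - a C) * (b C - s))"
        by (simp add: real_sqrt_mult)
      then show ?thesis by (simp add: P_def)
    qed
    ultimately show "((\<lambda>s. \<Theta> (arcsin (y s))) has_vector_derivative
        R C s / (cos s * sqrt ((L s)\<^sup>2 - (R C s)\<^sup>2))) (at s)"
      by (simp add: has_real_derivative_iff_has_vector_derivative)
  qed
  moreover have "arcsin (y (\<sigma> C \<phi>)) = \<phi>" using assms by (simp add: y\<sigma> arcsin_sin)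
  moreover have "y (a C) = -1" using y1[of "a C"] by simp
  ultimately show *: "((\<lambda>s. R C s / (cos s * sqrt ((L s)\<^sup>2 - (R C s)\<^sup>2))) has_integral \<Theta> \<phi>) {a C..\<sigma> C \<phi>}"
    by (simp add: \<Theta>(2))
  then show "s_1 (m + 3) h C (\<sigma> C \<phi>) = \<Theta> \<phi>"
    unfolding s_1_def z_L_R[OF C] by (rule integral_unique)
qed

lemma \<sigma>_pi_half: "\<sigma> C (pi / 2) = b C" "\<sigma> C (- (pi / 2)) = a C"
  by (simp_all add: \<sigma>_def field_simps)

lemma half_period_eq: "half_period (m + 3) h C = T C"
  using s_1_\<sigma>(1)[of "pi / 2"] by (simp add: half_period_def z_L_R[OF C] \<sigma>_pi_half T_eq)

lemma W_eq: "W (m + 3) h C = 2 * T C"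
  by (simp add: W_def half_period_eq)

lemma integrand_has_integral:
  "((\<lambda>s. R C s / (cos s * sqrt ((L s)\<^sup>2 - (R C s)\<^sup>2))) has_integral T C) {a C..b C}"
  using s_1_\<sigma>(2)[of "pi / 2"] by (simp add: \<sigma>_pi_half T_eq)

lemma \<sigma>_surj:
  assumes "s \<in> {a C..b C}"
  shows "\<exists>\<phi>\<in>{- (pi / 2)..pi / 2}. \<sigma> C \<phi> = s"
  using IVT'[of "\<sigma> C" "- (pi / 2)" s "pi / 2"] assms continuous_\<sigma>[of "{- (pi / 2)..pi / 2}" "\<lambda>x. x" "\<lambda>_. C"] C
  by (auto simp: \<sigma>_pi_half Bex_def)

text \<open>Injectivity of \<open>s_1\<close> is inherited: every point of the interval is some
  \<open>\<sigma> C x\<close>, and equal values of \<open>\<Theta>\<close> force equal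
  phases.\<close>

lemma the_inv_s_1:
  assumes "\<phi> \<in> {- (pi / 2)..pi / 2}"
  shows "the_inv_into {z_L (m + 3) h C..z_R (m + 3) h C} (s_1 (m + 3) h C) (\<Theta> \<phi>) = \<sigma> C \<phi>"
proof (rule the_inv_into_f_eq)
  show "inj_on (s_1 (m + 3) h C) {z_L (m + 3) h C..z_R (m + 3) h C}"
    unfolding z_L_R[OF C]
  proof (rule inj_onI)
    fix s s' assume ss: "s \<in> {a C..b C}" "s' \<in> {a C..b C}" and eq: "s_1 (m + 3) h C s = s_1 (m + 3) h C s'"
    obtain x x' where "x \<in> {- (pi / 2)..pi / 2}" "\<sigma> C x = s" "x' \<in> {- (pi / 2)..pi / 2}" "\<sigma> C x' = s'"
      using \<sigma>_surj[OF ss(1)] \<sigma>_surj[OF ss(2)] by blast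
    then show "s = s'" using s_1_\<sigma>(1)[of x] s_1_\<sigma>(1)[of x'] eq by auto
  qed
qed (use s_1_\<sigma>(1)[OF assms] \<sigma>_range[OF C(1) C'] z_L_R[OF C] in auto)

text \<open>The distance \<open>\<tau>\<close> from \<open>t\<close> to the nearest multiple of
  \<open>W\<close> lies in \<open>[0, T C]\<close>, so its phase is in the range where
  \<open>the_inv_s_1\<close> applies. Shift, preceded by reflection if \<open>t\<close> lies left of
  that multiple, relates the phases of \<open>t\<close> and \<open>\<tau>\<close>.\<close>

lemma \<rho>_eq: "\<rho> (m + 3) h C t = r t"
proof -
  let ?W = "2 * T C"
  define j where "j = round (t / ?W)"
  define \<tau> where "\<tau> = \<bar>t - ?W * of_int j\<bar>"
  have "\<bar>t / ?W - of_int j\<bar> \<le> 1 / 2" unfolding j_def using of_int_round_abs_le[of "t / ?W"] by (simp add: abs_minus_commute)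
  moreover have "\<tau> = ?W * \<bar>t / ?W - of_int j\<bar>"
  proof -
    have "t - ?W * of_int j = ?W * (t / ?W - of_int j)" using T_pos by (simp add: field_simps)
    then show ?thesis unfolding \<tau>_def using T_pos by (simp add: abs_mult)
  qed
  ultimately have "\<tau> \<le> ?W * (1 / 2)" using T_pos by (simp add: mult_left_mono del: times_divide_eq_right)
  then have \<tau>: "0 \<le> \<tau>" "\<tau> \<le> T C" by (auto simp: \<tau>_def)
  have \<psi>\<tau>: "\<psi> \<tau> \<in> {- (pi / 2)..pi / 2}"
  proof -
    have "\<not> \<Theta> (\<psi> \<tau>) < \<Theta> (- (pi / 2))" "\<not> \<Theta> (pi / 2) < \<Theta> (\<psi> \<tau>)"
      using \<tau> unfolding \<Theta>_\<psi> by (simp_all add: \<Theta>(2) T_eq)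
    then show ?thesis unfolding \<Theta>_less_iff by auto
  qed
  have "\<rho> (m + 3) h C t = \<sigma> C (\<psi> \<tau>)"
    using the_inv_s_1[OF \<psi>\<tau>] by (simp add: \<rho>_def W_eq \<tau>_def j_def)
  moreover have "r t = \<sigma> C (\<psi> \<tau>)"
  proof (cases "t - ?W * of_int j \<ge> 0")
    case True
    then have "t = \<Theta> (\<psi> \<tau> + 2 * pi * of_int j)" unfolding \<Theta>_shift_int by (simp add: \<tau>_def)
    then have "\<psi> t = \<psi> \<tau> + 2 * pi * of_int j" by (metis \<psi>_\<Theta>)
    then show ?thesis by (simp only: r_def \<sigma>_periodic)
  next
    case False
    then have "t = \<Theta> (- pi - \<psi> \<tau> + 2 * pi * of_int j)"
      unfolding \<Theta>_shift_int \<Theta>_reflect by (simp add: \<tau>_def)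
    then have "\<psi> t = - pi - \<psi> \<tau> + 2 * pi * of_int j" by (metis \<psi>_\<Theta>)
    then show ?thesis by (simp only: r_def \<sigma>_periodic \<sigma>_reflect)
  qed
  ultimately show ?thesis by simp
qed

section \<open>Periods of the oscillation and closing of the curve\<close>

lemma r_periodic: "r (t + 2 * T C * of_int j) = r t"
proof -
  have "t + 2 * T C * of_int j = \<Theta> (\<psi> t + 2 * pi * of_int j)" by (simp add: \<Theta>_shift_int)
  then have "\<psi> (t + 2 * T C * of_int j) = \<psi> t + 2 * pi * of_int j" by (metis \<psi>_\<Theta>)
  then show ?thesis by (simp only: r_def \<sigma>_periodic)
qed

lemma r_0: "r 0 = a C"
  using \<psi>_\<Theta>[of "- (pi / 2)"] by (simp add: r_def \<Theta>(2) \<sigma>_pi_half)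

lemma r_minimum:
  assumes "r t = a C"
  shows "\<exists>j::int. t = 2 * T C * of_int j"
proof -
  have "(b C - a C) / 2 * (1 + sin (\<psi> t)) = 0"
    using assms by (simp add: r_def \<sigma>_def field_simps)
  then have "sin (\<psi> t) = -1" using ab_strict[OF C] by (simp add: add_eq_0_iff2)
  then have "sin (\<psi> t) = sin (- (pi / 2)) \<and> cos (\<psi> t) = cos (- (pi / 2))"
    using sin_cos_squared_add[of "\<psi> t"] by simp
  then obtain j :: int where "\<psi> t = - (pi / 2) + 2 * pi * of_int j"
    unfolding sin_cos_eq_iff by auto
  then have "\<Theta> (\<psi> t) = 2 * T C * of_int j" by (simp only: \<Theta>_shift_int \<Theta>(2) add_0)
  then show ?thesis by auto
qed

text \<open>A period \<open>q\<close> brings the motion from its minimum at time 0 back to the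
  minimum, which by \<open>r_minimum\<close> happens only at multiples of
  \<open>2 * T C\<close>.\<close>

lemma least_period_sin_r: "least_period (\<lambda>t. sin (r t)) (2 * T C)"
  unfolding least_period_def
proof (intro conjI allI impI)
  show "0 < 2 * T C" using T_pos by simp
  show "sin (r (t + 2 * T C)) = sin (r t)" for t using r_periodic[of t 1] by simp
  fix q assume q: "0 < q \<and> (\<forall>t. sin (r (t + q)) = sin (r t))"
  then have "sin (r q) = sin (r 0)" by (metis add_0)
  then have "arcsin (sin (r q)) = arcsin (sin (r 0))" by (simp only:)
  moreover have "arcsin (sin (r t)) = r t" for t
    using motion.r(1)[of t] motion.r(2)[of t] by (intro arcsin_sin) linarith+
  ultimately have "r q = r 0" by (simp only:)
  then obtain j :: int where j: "q = 2 * T C * of_int j" using r_minimum[of q] unfolding r_0 by blast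
  then have "0 < of_int j * T C" using q by simp
  then have "1 \<le> j" using T_pos by (simp add: zero_less_mult_iff)
  then have "2 * T C * 1 \<le> 2 * T C * of_int j" using T_pos by (intro mult_left_mono) auto
  then show "2 * T C \<le> q" by (simp add: j)
qed

lemma delaunay_curve_eq: "delaunay_curve (m + 3) h C = motion.\<gamma>"
  by (simp add: fun_eq_iff delaunay_curve_def motion.\<gamma>_def \<rho>_eq)

text \<open>The condition on \<open>W\<close> says that \<open>k\<close> oscillations take time
  \<open>2 * pi\<close>, one turn of \<open>cis\<close>.\<close>

lemma delaunay_hypersurface:
  assumes dim: "DIM('a::euclidean_space) = m + 2" and k: "0 < k" and W: "W (m + 3) h C = 2 * pi / real k"
  shows "profile_curve (delaunay_curve (m + 3) h C)"
    and "embedded_with_period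
      (rot_hypersurface (delaunay_curve (m + 3) h C) :: real \<times> 'a \<Rightarrow> complex \<times> 'a) (real k * W (m + 3) h C)"
    and "has_constant_mean_curvature
      (rot_hypersurface (delaunay_curve (m + 3) h C) :: real \<times> 'a \<Rightarrow> complex \<times> 'a) h"
    and "least_period (\<lambda>t. snd (delaunay_curve (m + 3) h C t)) (W (m + 3) h C)"
proof -
  have kW: "real k * W (m + 3) h C = 2 * pi" using k W by simp
  show "profile_curve (delaunay_curve (m + 3) h C)"
    unfolding delaunay_curve_eq by (rule motion.profile_curve_\<gamma>)
  show "has_constant_mean_curvature
      (rot_hypersurface (delaunay_curve (m + 3) h C) :: real \<times> 'a \<Rightarrow> complex \<times> 'a) h"
    unfolding delaunay_curve_eq by (rule motion.constant_mean_curvature_\<gamma>[OF dim])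
  show "least_period (\<lambda>t. snd (delaunay_curve (m + 3) h C t)) (W (m + 3) h C)"
    unfolding delaunay_curve_eq W_eq using least_period_sin_r by (simp add: motion.\<gamma>_def)
  have kT: "2 * T C * of_int (int k) = 2 * pi" using kW by (simp add: W_eq mult_ac)
  have "r (t + 2 * pi) = r t" for t using r_periodic[of t "int k"] by (simp only: kT)
  then show "embedded_with_period
      (rot_hypersurface (delaunay_curve (m + 3) h C) :: real \<times> 'a \<Rightarrow> complex \<times> 'a) (real k * W (m + 3) h C)"
    unfolding delaunay_curve_eq kW by (rule motion.embedded_\<gamma>)
qed

end

section \<open>Small values of \<open>C\<close>\<close>

context delaunay
begin

definition \<alpha> where "\<alpha> = h / (real m + 2)"
text \<open>The integrand of \<open>s_1\<close> depends on \<open>L\<close> and \<open>R\<close>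
  only through this quotient. By \<open>q_eq\<close> it splits into a part proportional to
  \<open>C\<close>, relevant near 0, and \<open>\<alpha> * tan s\<close>, which remains as
  \<open>C\<close> tends to 0.\<close>

definition q where "q C s = R C s / L s"

lemma \<alpha>_pos: "0 < \<alpha>" using h by (simp add: \<alpha>_def)

lemma q_eq: "0 < s \<Longrightarrow> s < pi / 2 \<Longrightarrow> q C s = C / L s + \<alpha> * tan s"
proof -
  assume "0 < s" "s < pi / 2"
  then have "sin s \<noteq> 0" "cos s \<noteq> 0" using sin_gt_zero[of s] cos_gt_zero[of s] by linarith+
  then show ?thesis
    by (simp add: q_def R_fun_add3 L_fun_add3 \<alpha>_def tan_def add_divide_distrib)
qed

lemma DERIV_q:
  assumes "0 < s" "s < pi / 2"
  shows "(q C has_real_derivative \<alpha> / (cos s)\<^sup>2 - C * L_deriv m s / (L s)\<^sup>2) (at s)"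
proof -
  have "cos s \<noteq> 0" using cos_gt_zero[of s] assms by linarith
  moreover have "L s \<noteq> 0" using L_fun_pos[of s m] assms by simp
  ultimately have "((\<lambda>s. C / L s + \<alpha> * tan s) has_real_derivative
      \<alpha> / (cos s)\<^sup>2 - C * L_deriv m s / (L s)\<^sup>2) (at s)"
    by (auto intro!: derivative_eq_intros DERIV_L_fun simp: power2_eq_square divide_inverse)
  then show ?thesis
    by (rule has_field_derivative_transform_within_open[of _ _ _ "{0<..<pi / 2}"])
      (use assms in \<open>auto simp: q_eq\<close>)
qed

text \<open>Left of \<open>sc\<close> the derivative of \<open>L\<close> is
  \<open>g1 + h * L\<close>, a sum of positive terms.\<close>

lemma L_increasing: "0 \<le> s \<Longrightarrow> s \<le> s' \<Longrightarrow> s' \<le> sc \<Longrightarrow> L s \<le> L s'"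
proof (cases "s = s'")
  case False
  assume s: "0 \<le> s" "s \<le> s'" "s' \<le> sc"
  have "L s < L s'"
  proof (rule DERIV_pos_imp_increasing_open[where f = L])
    show "s < s'" using s False by simp
    fix x assume "s < x" "x < s'"
    then have "0 < g1 x" "0 < h * L x" using s g1_pos[of x] L_fun_pos[of x m] h s_crit by auto
    then have "0 < L_deriv m x" by (simp add: g1_def)
    then show "\<exists>y. (L has_real_derivative y) (at x) \<and> 0 < y" using DERIV_L_fun by blast
  next
    show "continuous_on {s..s'} L"
      by (rule DERIV_continuous_on) (rule has_field_derivative_at_within[OF DERIV_L_fun])
  qed
  then show ?thesis by simp
qed simp

lemma L_deriv_le:
  assumes "0 \<le> s" "s \<le> pi / 2"
  shows "L_deriv m s \<le> real m + 1"
proof -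
  have s: "0 \<le> sin s" "sin s \<le> 1" using assms sin_ge_zero[of s] pi_gt_zero by (auto simp del: pi_gt_zero)
  have "(cos s)\<^sup>2 \<le> 1" "sin s ^ m \<le> 1" using s by (simp_all add: abs_square_le_1 power_le_one)
  then have "(cos s)\<^sup>2 * sin s ^ m \<le> 1 * 1" using s by (intro mult_mono) auto
  then have "(real m + 1) * ((cos s)\<^sup>2 * sin s ^ m) \<le> (real m + 1) * 1" by (intro mult_left_mono) auto
  moreover have "0 \<le> sin s ^ (m + 2)" using s by simp
  moreover have "- u + w \<le> z" if "w \<le> z * 1" "0 \<le> u" for u w z :: real using that by simp
  ultimately show ?thesis unfolding L_deriv_def mult.assoc by blast
qed

end

context delaunay_oscillation
begin

abbreviation f where "f s \<equiv> R C s / (cos s * sqrt ((L s)\<^sup>2 - (R C s)\<^sup>2))"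

text \<open>The identity includes the turning points: there \<open>q C s = 1\<close>, and both sides
  are 0 by the convention for division by 0.\<close>

lemma f_eq:
  assumes "s \<in> {a C..b C}"
  shows "f s = q C s / (cos s * sqrt (1 - (q C s)\<^sup>2))" and "0 < q C s" "q C s \<le> 1"
proof -
  note p = pos_between[OF C(1) C' assms]
  show "0 < q C s" using p by (simp add: q_def)
  have "0 \<le> (s - a C) * (b C - s) * D C s"
    using assms D_pos[OF C(1) C' assms] by (intro mult_nonneg_nonneg) auto
  then have "R C s \<le> L s" unfolding D_eq[OF C] L_minus_R[symmetric] by simp
  then show "q C s \<le> 1" using p by (simp add: q_def)
  have "(L s)\<^sup>2 - (R C s)\<^sup>2 = (L s)\<^sup>2 * (1 - (q C s)\<^sup>2)"
  proof -
    have "(L s)\<^sup>2 * (q C s)\<^sup>2 = (R C s)\<^sup>2" using p by (simp add: q_def power_divide)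
    then show ?thesis by (simp only: right_diff_distrib mult_1_right)
  qed
  then have "sqrt ((L s)\<^sup>2 - (R C s)\<^sup>2) = L s * sqrt (1 - (q C s)\<^sup>2)"
    using p by (simp add: real_sqrt_mult)
  then show "f s = q C s / (cos s * sqrt (1 - (q C s)\<^sup>2))"
    by (simp add: q_def)
qed

lemma f_integrable: "{x..y} \<subseteq> {a C..b C} \<Longrightarrow> f integrable_on {x..y}"
  using integrable_on_subinterval[of f "{a C..b C}" x y] integrand_has_integral by (auto simp: has_integral_integrable)

text \<open>The function \<open>- sqrt (1 - q\<^sup>2) / c\<close> is an antiderivative of \<open>q q' / (c sqrt (1 - q\<^sup>2))\<close>.\<close>

lemma integral_f_le:
  assumes le: "x \<le> y" and sub: "{x..y} \<subseteq> {a C..b C}" and c: "0 < c" and e: "e = 1 \<or> e = -1"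
    and slope: "\<And>s. s \<in> {x..y} \<Longrightarrow> c \<le> e * (\<alpha> / (cos s)\<^sup>2 - C * L_deriv m s / (L s)\<^sup>2) * cos s"
  shows "integral {x..y} f \<le> 1 / c"
proof -
  let ?q' = "\<lambda>s. \<alpha> / (cos s)\<^sup>2 - C * L_deriv m s / (L s)\<^sup>2"
  let ?w = "\<lambda>s. sqrt (1 - (q C s)\<^sup>2)"
  have I: "((\<lambda>s. e / c * (q C s * ?q' s / ?w s)) has_integral - (e / c) * ?w y - - (e / c) * ?w x) {x..y}"
  proof (rule fundamental_theorem_of_calculus_interior[OF le])
    have "continuous_on {x..y} (q C)"
    proof (rule DERIV_continuous_on, rule has_field_derivative_at_within[OF DERIV_q])
      fix s assume "s \<in> {x..y}"
      then have "s \<in> {a C..b C}" using sub by blast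
      then show "0 < s" "s < pi / 2" using pos_between[OF C(1) C'] by blast+
    qed
    then show "continuous_on {x..y} (\<lambda>s. - (e / c) * ?w s)" by (intro continuous_intros)
  next
    fix s assume s: "s \<in> {x<..<y}"
    moreover have "x \<in> {a C..b C}" "y \<in> {a C..b C}" using sub le by auto
    ultimately have sI: "s \<in> {a C..b C}" and s': "a C < s" "s < b C" by auto
    note p = pos_between[OF C(1) C' sI]
    have "R C s < L s" using g_gt[OF C s'] L_minus_R[of s C] by linarith
    then have q1: "0 < q C s" "q C s < 1" using p by (simp_all add: q_def)
    then have "(q C s)\<^sup>2 < 1\<^sup>2" by (intro power_strict_mono) auto
    then have q2: "0 < 1 - (q C s)\<^sup>2" by simp
    have "((\<lambda>s. 1 - (q C s)\<^sup>2) has_real_derivative 0 - real 2 * (?q' s * q C s ^ (2 - Suc 0))) (at s)"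
      by (intro DERIV_diff DERIV_const DERIV_power DERIV_q p)
    then have "((\<lambda>s. 1 - (q C s)\<^sup>2) has_real_derivative - (2 * q C s * ?q' s)) (at s)"
      by (simp add: mult_ac)
    from DERIV_cmult[OF DERIV_chain2[OF DERIV_real_sqrt[OF q2] this], of "- (e / c)"]
    have "((\<lambda>s. - (e / c) * ?w s) has_real_derivative
      - (e / c) * (inverse (?w s) / 2 * - (2 * q C s * ?q' s))) (at s)" .
    moreover have "- (e / c) * (inverse w / 2 * - (2 * u * z)) = e / c * (u * z / w)" for w u z :: real
      by (simp only: divide_inverse inverse_mult_distrib minus_mult_minus mult_minus_left mult_minus_right
          minus_minus) simp
    ultimately have "((\<lambda>s. - (e / c) * ?w s) has_real_derivative e / c * (q C s * ?q' s / ?w s)) (at s)"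
      by (simp only:)
    then show "((\<lambda>s. - (e / c) * ?w s) has_vector_derivative e / c * (q C s * ?q' s / ?w s)) (at s)"
      by (simp add: has_real_derivative_iff_has_vector_derivative)
  qed
  have "integral {x..y} f \<le> - (e / c) * ?w y - - (e / c) * ?w x"
  proof (rule has_integral_le[OF integrable_integral[OF f_integrable[OF sub]] I])
    fix s assume s: "s \<in> {x..y}"
    then have sI: "s \<in> {a C..b C}" using sub by blast
    note p = pos_between[OF C(1) C' sI] and q = f_eq[OF sI]
    have w: "0 \<le> ?w s" using q by (simp add: power_le_one)
    have "1 \<le> e / c * ?q' s * cos s" using slope[OF s] c by (simp add: field_simps)
    then have "1 / cos s \<le> e / c * ?q' s" using p(4) by (simp add: field_simps)
    \<comment> \<open>At a turning point \<open>?w s = 0\<close> and the common factor is 0 by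
      convention, so the comparison holds on the closed interval.\<close>
    then have "(1 / cos s) * (q C s / ?w s) \<le> (e / c * ?q' s) * (q C s / ?w s)"
      using q w by (intro mult_right_mono) auto
    then show "f s \<le> e / c * (q C s * ?q' s / ?w s)"
      unfolding q(1) by (simp add: mult_ac)
  qed
  also have "\<dots> \<le> 1 / c"
  proof -
    have "?w s \<in> {0..1}" if "s \<in> {x..y}" for s
      using f_eq[of s] sub that by (auto simp: power_le_one)
    then have "?w x \<in> {0..1}" "?w y \<in> {0..1}" using le by auto
    \<comment> \<open>Both roots lie in \<open>[0, 1]\<close>, which makes the bound independent of
      the length of the interval.\<close>
    moreover have "e * (u - v) \<le> 1" if "u \<in> {0..1}" "v \<in> {0..1}" for u v using that e by auto
    ultimately have "e * (?w x - ?w y) \<le> 1" by blast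
    then have "e * (?w x - ?w y) / c \<le> 1 / c" using c by (simp add: divide_right_mono)
    then show ?thesis by (simp add: algebra_simps diff_divide_distrib)
  qed
  finally show ?thesis .
qed

text \<open>The numerator of \<open>f\<close> is at most \<open>1 / 2\<close> and its denominator at
  least \<open>1 / 4\<close>.\<close>

lemma integral_f_le_length:
  assumes le: "x \<le> y" and sub: "{x..y} \<subseteq> {a C..b C}"
    and bd: "\<And>s. s \<in> {x..y} \<Longrightarrow> q C s \<le> 1 / 2 \<and> 1 / 2 \<le> cos s"
  shows "integral {x..y} f \<le> 2 * (y - x)"
proof -
  have "integral {x..y} f \<le> integral {x..y} (\<lambda>_. 2)"
  proof (rule integral_le[OF f_integrable[OF sub]])
    fix s assume s: "s \<in> {x..y}"
    then have sI: "s \<in> {a C..b C}" using sub by blast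
    note q = f_eq[OF sI]
    have "(q C s)\<^sup>2 \<le> (1 / 2)\<^sup>2" using q bd[OF s] by (intro power_mono) auto
    then have "(1 / 2)\<^sup>2 \<le> 1 - (q C s)\<^sup>2" by (simp add: power2_eq_square)
    then have "1 / 2 \<le> sqrt (1 - (q C s)\<^sup>2)" by (rule real_le_rsqrt)
    then have "1 / 2 * (1 / 2) \<le> cos s * sqrt (1 - (q C s)\<^sup>2)" using bd[OF s] by (intro mult_mono) auto
    moreover have "q C s \<le> 1 / 2" using bd[OF s] by simp
    ultimately have "q C s / (cos s * sqrt (1 - (q C s)\<^sup>2)) \<le> (1 / 2) / (1 / 2 * (1 / 2))"
      using q by (intro frac_le) auto
    then show "f s \<le> 2" unfolding q(1) by simp
  qed (rule integrable_const_ivl)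
  also have "\<dots> = 2 * (y - x)" using le by simp
  finally show ?thesis .
qed

end

context delaunay
begin

text \<open>
  For \<open>C = L p / 4\<close> with small \<open>p\<close> the quotient \<open>q = R / L\<close> decreases steeply on \<open>[z\<^sub>L, p]\<close>, is at most
  \<open>1/2\<close> on the short interval \<open>[p, \<delta>]\<close>, and satisfies \<open>q' cos \<ge> \<alpha>'\<close> on \<open>[\<delta>, z\<^sub>R]\<close>, where \<open>\<alpha>'\<close> is close to
  \<open>\<alpha> = h / (n - 1)\<close>.
\<close>

lemma T_small:
  assumes \<epsilon>: "0 < \<epsilon>"
  shows "\<exists>C. 0 < C \<and> C < g sc \<and> T C \<le> 1 / \<alpha> + \<epsilon>"
proof -
  \<comment> \<open>The error \<open>\<epsilon>\<close> is split into thirds: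
    \<open>1 / M = \<epsilon> / 3\<close> on the first interval,
    \<open>2 * \<delta> \<le> \<epsilon> / 3\<close> on the second,
    \<open>1 / \<alpha>' = 1 / \<alpha> + \<epsilon> / 3\<close> on the third.\<close>
  define M where "M = 3 / \<epsilon>"
  define \<alpha>' where "\<alpha>' = 1 / (1 / \<alpha> + \<epsilon> / 3)"
  \<comment> \<open>An upper bound for the right turning point that does not depend on
    \<open>C\<close>.\<close>
  define \<beta> where "\<beta> = arctan (1 / \<alpha>)"
  \<comment> \<open>The entries keep \<open>\<delta>\<close> left of \<open>sc\<close>,
    \<open>cos \<ge> 1 / 2\<close>, the middle interval short, and
    \<open>\<alpha> * tan \<le> 1 / 4\<close> up to \<open>\<delta>\<close>.\<close>
  define \<delta> where "\<delta> = Min {sc / 2, pi / 3, \<epsilon> / 6, arctan (1 / (4 * \<alpha>))}"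
  have M: "0 < M" using \<epsilon> by (simp add: M_def)
  have \<alpha>': "0 < \<alpha>'" "\<alpha>' < \<alpha>"
  proof -
    show "0 < \<alpha>'" using \<epsilon> \<alpha>_pos by (auto simp: \<alpha>'_def intro!: divide_pos_pos add_pos_pos)
    have "0 < 1 / \<alpha> + \<epsilon> / 3" "0 < \<alpha> * (\<epsilon> / 3)" using \<epsilon> \<alpha>_pos by (auto intro!: add_pos_pos)
    moreover have "\<alpha> * (1 / \<alpha> + \<epsilon> / 3) = 1 + \<alpha> * (\<epsilon> / 3)" using \<alpha>_pos by (simp add: distrib_left)
    ultimately show "\<alpha>' < \<alpha>" unfolding \<alpha>'_def by (intro mult_imp_div_pos_less) linarith+
  qed
  have \<delta>: "0 < \<delta>" "\<delta> < sc" "\<delta> \<le> pi / 3" "2 * \<delta> \<le> \<epsilon> / 3" "\<delta> \<le> arctan (1 / (4 * \<alpha>))"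
    using s_crit \<epsilon> \<alpha>_pos unfolding \<delta>_def by (auto simp: min_def)
  have \<beta>: "0 < \<beta>" "\<beta> < pi / 2" "tan \<beta> = 1 / \<alpha>"
    using \<alpha>_pos arctan_ubound[of "1 / \<alpha>"] by (auto simp: \<beta>_def tan_arctan)
  \<comment> \<open>A lower bound for \<open>L\<close> between \<open>\<delta>\<close> and
    \<open>\<beta>\<close>; it is independent of \<open>C\<close>, so \<open>p\<close> and then
    \<open>C\<close> may be chosen afterwards.\<close>
  define l where "l = cos \<beta> * sin \<delta> ^ (m + 1)"
  have "0 < cos \<beta>" "0 < sin \<delta>"
    using \<beta> \<delta> s_crit cos_gt_zero[of \<beta>] sin_gt_zero[of \<delta>] by linarith+
  then have l: "0 < l" by (simp add: l_def)
  \<comment> \<open>The second entry gives the slope \<open>M\<close> on the first interval. The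
    third keeps the part of the slope proportional to \<open>C\<close> below
    \<open>\<alpha> - \<alpha>'\<close> on the last interval, using \<open>C \<le> p\<close>. The
    fourth gives \<open>1 \<le> 1 / (4 * p)\<close>.\<close>
  define p where "p = Min {\<delta>, 1 / (16 * (M + 1 / 4 + 2 * \<alpha>)), (\<alpha> - \<alpha>') * l\<^sup>2 / (real m + 1), 1 / 4}"
  have X: "0 < M + 1 / 4 + 2 * \<alpha>" using M \<alpha>_pos by simp
  have p: "0 < p" "p \<le> \<delta>" "p \<le> 1 / (16 * (M + 1 / 4 + 2 * \<alpha>))" "p \<le> (\<alpha> - \<alpha>') * l\<^sup>2 / (real m + 1)" "p \<le> 1 / 4"
  proof -
    show "0 < p" unfolding p_def using \<delta> X \<alpha>' l by (subst Min_gr_iff) auto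
  qed (unfold p_def, (rule Min_le; simp)+)
  \<comment> \<open>Then \<open>C / L p = 1 / 4\<close>, and with
    \<open>\<alpha> * tan p \<le> 1 / 4\<close> the quotient \<open>q\<close> is at most
    \<open>1 / 2\<close> at \<open>p\<close>; hence \<open>p\<close> lies strictly between the
    turning points.\<close>
  define C where "C = L p / 4"
  have tan4: "\<alpha> * tan s \<le> 1 / 4" if "0 < s" "s \<le> \<delta>" for s
  proof -
    have "tan s \<le> tan (arctan (1 / (4 * \<alpha>)))"
      using that \<delta>(5) arctan_ubound[of "1 / (4 * \<alpha>)"] by (intro tan_mono_le) auto
    then have "tan s \<le> 1 / (4 * \<alpha>)" by (simp add: tan_arctan)
    then show ?thesis using \<alpha>_pos by (simp add: field_simps)
  qed
  have q_half: "s < pi / 2" if "s \<le> sc" for s using that s_crit by simp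
  have Lp: "0 < L p" using p \<delta> by (intro L_fun_pos q_half) auto
  then have C0: "0 < C" by (simp add: C_def)
  have "q C p \<le> 1 / 2"
    using q_eq[of p C] q_half[of p] p \<delta> tan4[of p] Lp by (simp add: C_def)
  then have "R C p \<le> 1 / 2 * L p" using Lp by (simp add: q_def field_simps)
  then have gp: "C < g p" using Lp L_minus_R[of p C] by linarith
  then have Cg: "C < g sc" using g_increasing[of p sc] p \<delta> by auto
  interpret delaunay_oscillation m h C by unfold_locales (fact C0 Cg)+
  have ap: "a C < p"
    using g_le[OF C0 Cg, of p] gp p \<delta> q_half[of p] by force
  have b: "sc < b C" using ab_strict[OF C0 Cg] by simp
  have b\<beta>: "b C < \<beta>"
  proof -
    have bI: "b C \<in> {a C..b C}" using ap b p \<delta> by simp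
    note pb = pos_between[OF C0 less_imp_le[OF Cg] bI]
    \<comment> \<open>\<open>q\<close> is at most 1 at the turning point, and its part
      \<open>C / L\<close> is positive.\<close>
    have "\<alpha> * tan (b C) < 1"
      using f_eq(3)[OF bI] q_eq[of "b C" C] pb C0 by (smt (verit) divide_pos_pos)
    then have "tan (b C) < 1 / \<alpha>" using \<alpha>_pos by (simp add: field_simps)
    then have "arctan (tan (b C)) < \<beta>" unfolding \<beta>_def arctan_less_iff .
    moreover have "arctan (tan (b C)) = b C" using pb by (intro arctan_tan) linarith+
    ultimately show ?thesis by simp
  qed
  have sub: "{a C..p} \<subseteq> {a C..b C}" "{p..\<delta>} \<subseteq> {a C..b C}" "{\<delta>..b C} \<subseteq> {a C..b C}" "{p..b C} \<subseteq> {a C..b C}"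
    using ap p \<delta> b by auto
  have cos_half: "1 / 2 \<le> cos s" if "0 \<le> s" "s \<le> \<delta>" for s
    using cos_monotone_0_pi_le[of s "pi / 3"] that \<delta> by (simp add: cos_60)
  have LLp: "L s \<le> L p" if "0 \<le> s" "s \<le> p" for s
    using that p \<delta> by (intro L_increasing) auto
  have I1: "integral {a C..p} f \<le> 1 / M"
  proof (rule integral_f_le[OF less_imp_le[OF ap] sub(1) M, of "-1"])
    fix s assume s: "s \<in> {a C..p}"
    then have "s \<in> {a C..b C}" using sub by blast
    note ps = pos_between[OF C0 less_imp_le[OF Cg] this]
    have cs: "1 / 2 \<le> cos s" using cos_half[of s] s ps p by auto
    have "sin s \<le> p" using sin_x_le_x[of s] ps s by auto
    then have "1 / p \<le> 1 / sin s" using ps by (simp add: frac_le)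
    have "(1 / 2)\<^sup>2 \<le> (cos s)\<^sup>2" using cs by (intro power_mono) auto
    then have "1 * (1 / 4) * (1 / p) \<le> (real m + 1) * (cos s)\<^sup>2 * (1 / sin s)"
      using p ps \<open>1 / p \<le> 1 / sin s\<close> by (intro mult_mono) (auto simp: power2_eq_square)
    \<comment> \<open>The steepness near 0 comes from the term in \<open>1 / sin s\<close>, which is
      at least \<open>1 / p\<close> because \<open>sin s \<le> p\<close>.\<close>
    moreover have "L_deriv m s * cos s / L s = (real m + 1) * (cos s)\<^sup>2 * (1 / sin s) - sin s"
      using ps(3,4) by (simp add: L_deriv_def L_fun_add3 field_simps power2_eq_square)
    moreover have "1 * (1 / 4) * (1 / p) = 1 / (4 * p)" by simp
    ultimately have k: "1 / (4 * p) - 1 \<le> L_deriv m s * cos s / L s" using sin_le_one[of s] by linarith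
    have p4: "1 \<le> 1 / (4 * p)" using p by simp
    have "1 / 4 \<le> C / L s" using LLp[of s] s ps by (simp add: C_def)
    then have "1 / 4 * (1 / (4 * p) - 1) \<le> C / L s * (L_deriv m s * cos s / L s)"
      using k p4 ps C0 by (intro mult_mono) auto
    moreover have "\<alpha> / cos s \<le> \<alpha> / (1 / 2)" using cs \<alpha>_pos by (intro divide_left_mono) auto
    moreover have "M + 1 / 4 + 2 * \<alpha> \<le> 1 / (16 * p)"
      using p X by (simp add: field_simps)
    ultimately have "M \<le> C / L s * (L_deriv m s * cos s / L s) - \<alpha> / cos s" by simp
    also have "\<dots> = - 1 * (\<alpha> / (cos s)\<^sup>2 - C * L_deriv m s / (L s)\<^sup>2) * cos s"
      using ps by (simp add: field_simps power2_eq_square)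
    finally show "M \<le> - 1 * (\<alpha> / (cos s)\<^sup>2 - C * L_deriv m s / (L s)\<^sup>2) * cos s" .
  qed simp
  have I2: "integral {p..\<delta>} f \<le> 2 * (\<delta> - p)"
  proof (rule integral_f_le_length[OF p(2) sub(2)])
    fix s assume s: "s \<in> {p..\<delta>}"
    then have "s \<in> {a C..b C}" using sub by blast
    note ps = pos_between[OF C0 less_imp_le[OF Cg] this]
    have "L p \<le> L s" using s p \<delta> by (intro L_increasing) auto
    then have "C / L s \<le> 1 / 4" using ps by (simp add: C_def)
    moreover have "\<alpha> * tan s \<le> 1 / 4" using tan4[of s] ps s by simp
    ultimately have "q C s \<le> 1 / 2" unfolding q_eq[OF ps(1,2)] by linarith
    then show "q C s \<le> 1 / 2 \<and> 1 / 2 \<le> cos s" using cos_half[of s] s ps by auto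
  qed
  have I3: "integral {\<delta>..b C} f \<le> 1 / \<alpha>'"
  proof (rule integral_f_le[OF _ sub(3) \<alpha>'(1), of 1])
    show "\<delta> \<le> b C" using \<delta> b by simp
    fix s assume s: "s \<in> {\<delta>..b C}"
    then have "s \<in> {a C..b C}" using sub by blast
    note ps = pos_between[OF C0 less_imp_le[OF Cg] this]
    have "cos \<beta> \<le> cos s" using s b\<beta> \<beta> ps by (intro cos_monotone_0_pi_le) auto
    moreover have "sin \<delta> ^ (m + 1) \<le> sin s ^ (m + 1)"
      using s ps \<delta> \<open>0 < sin \<delta>\<close> by (intro power_mono sin_monotone_2pi_le) auto
    ultimately have "l \<le> L s"
      unfolding l_def L_fun_add3 using \<open>0 < sin \<delta>\<close> ps by (intro mult_mono) auto
    then have "l\<^sup>2 \<le> (L s)\<^sup>2" using l by (intro power_mono) auto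
    moreover have "L_deriv m s * cos s \<le> (real m + 1) * 1"
      using L_deriv_le[of s] ps cos_le_one[of s]
      by (meson less_imp_le mult_left_mono mult_right_mono order_trans of_nat_0_le_iff add_nonneg_nonneg zero_le_one)
    \<comment> \<open>If the numerator is negative the bound is trivial; otherwise numerator and
      denominator are estimated separately.\<close>
    ultimately have 1: "L_deriv m s * cos s / (L s)\<^sup>2 \<le> (real m + 1) / l\<^sup>2"
      using l by (smt (verit) frac_le divide_nonpos_nonneg zero_le_power2 zero_less_power of_nat_0_le_iff divide_nonneg_nonneg)
    have "cos p * sin p ^ (m + 1) \<le> 1 * (sin p * 1)"
      using p \<delta> s_crit sin_gt_zero[of p] cos_gt_zero[of p]
      unfolding power_add power_one_right by (subst mult.commute[of "sin p ^ m"], intro mult_mono power_le_one) auto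
    then have "C \<le> p" using sin_x_le_x[of p] p unfolding C_def L_fun_add3 by simp
    then have "C * (L_deriv m s * cos s / (L s)\<^sup>2) \<le> C * ((real m + 1) / l\<^sup>2)"
      using 1 C0 by (intro mult_left_mono) auto
    also have "\<dots> \<le> p * ((real m + 1) / l\<^sup>2)" using \<open>C \<le> p\<close> by (intro mult_right_mono) auto
    also have "\<dots> \<le> \<alpha> - \<alpha>'" using p(4) l by (simp add: field_simps)
    finally have "\<alpha>' \<le> \<alpha> - C * (L_deriv m s * cos s / (L s)\<^sup>2)" by simp
    also have "\<dots> \<le> \<alpha> / cos s - C * (L_deriv m s * cos s / (L s)\<^sup>2)"
      using ps \<alpha>_pos cos_le_one[of s] by (simp add: field_simps)
    also have "\<dots> = 1 * (\<alpha> / (cos s)\<^sup>2 - C * L_deriv m s / (L s)\<^sup>2) * cos s"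
      using ps by (simp add: field_simps power2_eq_square)
    finally show "\<alpha>' \<le> 1 * (\<alpha> / (cos s)\<^sup>2 - C * L_deriv m s / (L s)\<^sup>2) * cos s" .
  qed simp
  have "T C = integral {a C..b C} f" using integrand_has_integral by (simp add: has_integral_iff)
  also have "\<dots> = integral {a C..p} f + integral {p..b C} f"
    using ap p \<delta> b by (intro Henstock_Kurzweil_Integration.integral_combine[symmetric] f_integrable) auto
  also have "integral {p..b C} f = integral {p..\<delta>} f + integral {\<delta>..b C} f"
    using sub p \<delta> b by (intro Henstock_Kurzweil_Integration.integral_combine[symmetric] f_integrable) auto
  also have "integral {a C..p} f + (integral {p..\<delta>} f + integral {\<delta>..b C} f) \<le>
      1 / M + (2 * (\<delta> - p) + 1 / \<alpha>')"
    by (intro add_mono I1 I2 I3)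
  also have "\<dots> \<le> \<epsilon> / 3 + (\<epsilon> / 3 + (1 / \<alpha> + \<epsilon> / 3))"
    using \<delta>(4) p by (simp add: M_def \<alpha>'_def)
  finally have "T C \<le> 1 / \<alpha> + \<epsilon>" by simp
  then show ?thesis using C0 Cg by blast
qed

section \<open>The upper bound on \<open>h\<close> and the intermediate value argument\<close>

lemma T_crit_gt:
  assumes k: "1 < k" and hk: "h < (k\<^sup>2 - 2) * sqrt ((real m + 1) / (k\<^sup>2 - 1))"
  shows "pi / k < T (g sc)"
proof -
  define M where "M = real m + 1"
  define K where "K = k\<^sup>2 - 1"
  define x where "x = cot sc"
  have M: "0 < M" by (simp add: M_def)
  have K: "0 < K" using k by (simp add: K_def one_less_power)
  have "0 < sin sc" "0 < cos sc" using s_crit sin_gt_zero[of sc] cos_gt_zero[of sc] by linarith+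
  then have x: "0 < x" "tan sc = 1 / x" by (auto simp: x_def cot_def tan_def)
  then have hx: "h = M * x - 1 / x" using s_crit(3) by (simp add: \<kappa>_def M_def x_def)
  \<comment> \<open>\<open>M * x - 1 / x\<close> increases in \<open>x\<close> and at
    \<open>sqrt (K / M)\<close> equals \<open>(K - 1) * sqrt (M / K)\<close>, the upper bound on
    \<open>h\<close>. The conclusion \<open>M * x\<^sup>2 < K\<close> is what the formula for
    \<open>T (g sc)\<close> asks for.\<close>
  have "x < sqrt (K / M)"
  proof (rule ccontr)
    assume "\<not> x < sqrt (K / M)"
    then have le: "sqrt (K / M) \<le> x" by simp
    have pos: "0 < sqrt (K / M)" using K M by simp
    have "M * sqrt (K / M) - 1 / sqrt (K / M) \<le> M * x - 1 / x"
      using le pos M x by (intro diff_mono mult_left_mono frac_le) auto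
    moreover have "M * sqrt (K / M) = K * sqrt (M / K)"
    proof -
      have "M * sqrt (K / M) = sqrt (M\<^sup>2 * (K / M))"
        using M real_sqrt_mult[of "M\<^sup>2" "K / M"] real_sqrt_abs[of M] by (simp only: abs_of_pos)
      also have "M\<^sup>2 * (K / M) = K\<^sup>2 * (M / K)" using M K by (simp add: power2_eq_square)
      also have "sqrt \<dots> = K * sqrt (M / K)"
        using K real_sqrt_mult[of "K\<^sup>2" "M / K"] real_sqrt_abs[of K] by (simp only: abs_of_pos)
      finally show ?thesis .
    qed
    moreover have "1 / sqrt (K / M) = sqrt (M / K)" by (simp add: real_sqrt_divide)
    ultimately have "(K - 1) * sqrt (M / K) \<le> h" unfolding hx by (simp add: algebra_simps)
    moreover have "K - 1 = k\<^sup>2 - 2" by (simp add: K_def)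
    ultimately show False using hk by (simp add: M_def K_def)
  qed
  then have "x\<^sup>2 < (sqrt (K / M))\<^sup>2" using x by (intro power_strict_mono) auto
  then have "M * x\<^sup>2 < K" using K M by (simp add: field_simps)
  then have "1 + M * x\<^sup>2 < k\<^sup>2" by (simp add: K_def)
  then have "sqrt (1 + M * x\<^sup>2) < k" using k by (intro real_less_lsqrt) auto
  moreover have "0 < sqrt (1 + M * x\<^sup>2)" using M by (auto intro!: add_pos_nonneg)
  ultimately have "pi / k < pi / sqrt (1 + M * x\<^sup>2)" using k by (intro divide_strict_left_mono mult_pos_pos) auto
  then show ?thesis by (simp add: T_crit M_def x_def)
qed

lemma T_attains:
  assumes k: "1 < k" and "k * (real m + 2) / pi < h"
    and hk: "h < (k\<^sup>2 - 2) * sqrt ((real m + 1) / (k\<^sup>2 - 1))"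
  shows "\<exists>C. 0 < C \<and> C < g sc \<and> T C = pi / k"
proof -
  have "k / pi < \<alpha>" using assms(2) by (simp add: \<alpha>_def field_simps)
  then have "1 / \<alpha> < pi / k" using k \<alpha>_pos by (simp add: field_simps)
  \<comment> \<open>The lower bound on \<open>h\<close> makes \<open>pi / k - 1 / \<alpha>\<close>
    positive, so it is an admissible error.\<close>
  then obtain C\<^sub>0 where C\<^sub>0: "0 < C\<^sub>0" "C\<^sub>0 < g sc" "T C\<^sub>0 \<le> pi / k"
    using T_small[of "pi / k - 1 / \<alpha>"] by auto
  have gt: "pi / k < T (g sc)" by (rule T_crit_gt[OF k hk])
  have "continuous_on {C\<^sub>0..g sc} T" by (rule continuous_on_subset[OF continuous_T]) (use C\<^sub>0 in auto)
  then obtain C where "C\<^sub>0 \<le> C" "C \<le> g sc" "T C = pi / k"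
    using IVT'[of T C\<^sub>0 "pi / k" "g sc"] C\<^sub>0 gt by auto
  \<comment> \<open>The level \<open>g sc\<close> itself is excluded because \<open>T\<close> is
    strictly larger there.\<close>
  then show ?thesis using gt C\<^sub>0 by (intro exI[of _ C]) (cases "C = g sc"; auto)
qed

end

section \<open>Nonemptiness of the interval for \<open>h\<close>\<close>

lemma pi_squared_ge: "936 / 100 \<le> pi\<^sup>2"
proof -
  \<comment> \<open>With the half-angle formula for \<open>cos (pi / 4)\<close> this yields
    \<open>pi\<^sup>2 \<ge> 32 - 16 * sqrt 2\<close>, and \<open>sqrt 2 \<le> 1.415\<close> gives
    the constant.\<close>
  have "(sin (pi / 8))\<^sup>2 \<le> (pi / 8)\<^sup>2"
    using sin_x_le_x[of "pi / 8"] sin_ge_zero[of "pi / 8"] pi_gt_zero by (intro power_mono) auto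
  moreover have "cos (pi / 4) = 1 - 2 * (sin (pi / 8))\<^sup>2"
    using cos_double_sin[of "pi / 8"] by simp
  moreover have "sqrt 2 \<le> 1415 / 1000" by (rule real_le_lsqrt) (auto simp: power2_eq_square)
  ultimately show ?thesis by (simp add: cos_45 power2_eq_square)
qed

text \<open>For large \<open>k\<close> both sides are nearly linear in \<open>k\<close>, so the
  inequality rests on \<open>(M + 1)\<^sup>2 / M < pi\<^sup>2\<close> with \<open>M = n - 2\<close>.
  At \<open>M = 7\<close> the left side is \<open>64 / 7\<close>, below 9.36; at
  \<open>M = 8\<close> it would be \<open>81 / 8\<close>, above \<open>pi\<^sup>2\<close>. This is
  the origin of the bound \<open>n \<le> 9\<close>.\<close>

lemma Z_nonempty:
  assumes m: "m \<le> 6" and k: "20 \<le> k"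
  shows "real k * (real m + 2) / pi < ((real k)\<^sup>2 - 2) * sqrt ((real m + 1) / ((real k)\<^sup>2 - 1))"
proof -
  define X where "X = (real k)\<^sup>2"
  have "20\<^sup>2 \<le> X" unfolding X_def using k by (intro power_mono) auto
  then have X: "400 \<le> X" by simp
  define M where "M = real m + 1"
  have M: "1 \<le> M" "M \<le> 7" using m by (auto simp: M_def)
  \<comment> \<open>This product is 7 times the difference of the two sides of the next inequality,
    which is sharp at \<open>M = 7\<close>.\<close>
  have "0 \<le> (7 * M - 1) * (7 - M)" using M by simp
  then have "(M + 1)\<^sup>2 \<le> 64 / 7 * M" by (simp add: power2_eq_square algebra_simps)
  then have "(M + 1)\<^sup>2 / pi\<^sup>2 \<le> (64 / 7 * M) / (936 / 100)"
    using pi_squared_ge M by (intro frac_le) auto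
  then have "X * ((M + 1)\<^sup>2 / pi\<^sup>2) \<le> X * ((64 / 7 * M) / (936 / 100))"
    using X by (intro mult_left_mono) auto
  also have "\<dots> = M * (X * (6400 / 6552))" by simp
  \<comment> \<open>The factor \<open>6400 / 6552\<close> is \<open>64 / 7\<close> divided by 9.36;
    the gap \<open>X * (152 / 6552)\<close> exceeds 3 already for
    \<open>X \<ge> 130\<close>.\<close>
  also have "\<dots> < M * (X - 3)" using M X by (intro mult_strict_left_mono) auto
  also have "X - 3 \<le> (X - 2)\<^sup>2 / (X - 1)"
    using X by (simp add: field_simps power2_eq_square)
  finally have "X * ((M + 1)\<^sup>2 / pi\<^sup>2) < (X - 2)\<^sup>2 * (M / (X - 1))" using M by (simp add: mult_ac)
  moreover have "(real k * (M + 1) / pi)\<^sup>2 = X * ((M + 1)\<^sup>2 / pi\<^sup>2)"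
    by (simp add: X_def power_divide power_mult_distrib)
  moreover have "((X - 2) * sqrt (M / (X - 1)))\<^sup>2 = (X - 2)\<^sup>2 * (M / (X - 1))"
    using M X by (simp add: power_mult_distrib)
  ultimately have "(real k * (M + 1) / pi)\<^sup>2 < ((X - 2) * sqrt (M / (X - 1)))\<^sup>2" by simp
  then have "real k * (M + 1) / pi < (X - 2) * sqrt (M / (X - 1))"
    using X M by (rule_tac power_less_imp_less_base) auto
  moreover have "M + 1 = real m + 2" by (simp add: M_def)
  ultimately show ?thesis by (simp add: X_def M_def add.commute)
qed

theorem theorem5p14:
  fixes n :: nat
  assumes "3 \<le> n" and "n \<le> 9"
    and "CARD('m::finite) = n - 1"
  shows "infinite {k::nat. k > 2 \<and> Z n k \<noteq> {} \<and>
    (\<forall>h\<in>Z n k.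
      (\<exists>C\<in>{0<..<C_crit n h}. W n h C = 2 * pi / real k) \<and>
      (\<forall>C\<in>{0<..<C_crit n h}. W n h C = 2 * pi / real k \<longrightarrow>
         profile_curve (delaunay_curve n h C) \<and>
         embedded_with_period
           (rot_hypersurface (delaunay_curve n h C) :: real \<times> (real^'m) \<Rightarrow> complex \<times> (real^'m))
           (real k * W n h C) \<and>
         has_constant_mean_curvature
           (rot_hypersurface (delaunay_curve n h C) :: real \<times> (real^'m) \<Rightarrow> complex \<times> (real^'m)) h \<and>
         least_period (\<lambda>t. snd (delaunay_curve n h C t)) (W n h C)))}"
    (is "infinite ?S")
proof -
  obtain m where n: "n = m + 3" using \<open>3 \<le> n\<close> by (metis add.commute le_Suc_ex)
  have m: "m \<le> 6" and dim: "DIM(real^'m) = m + 2" using assms n by simp_all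
  have Z: "Z n k = {real k * (real m + 2) / pi <..<
      ((real k)\<^sup>2 - 2) * sqrt ((real m + 1) / ((real k)\<^sup>2 - 1))}" for k
  proof -
    have "real n - 1 = real m + 2" "real n - 2 = real m + 1" by (simp_all add: n)
    then show ?thesis by (simp only: Z_def)
  qed
  \<comment> \<open>All \<open>k\<close> from 20 on belong to the set, which therefore contains an
    infinite final segment.\<close>
  have "k \<in> ?S" if k: "20 \<le> k" for k
  proof (intro CollectI conjI ballI impI)
    show "2 < k" using k by simp
    show "Z n k \<noteq> {}" using Z_nonempty[OF m k] by (simp add: Z)
  next
    fix h assume "h \<in> Z n k"
    then have hk: "real k * (real m + 2) / pi < h"
      "h < ((real k)\<^sup>2 - 2) * sqrt ((real m + 1) / ((real k)\<^sup>2 - 1))" by (auto simp: Z)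
    have "0 \<le> real k * (real m + 2) / pi" by simp
    then interpret delaunay m h using hk(1) by unfold_locales linarith
    have crit: "C_crit n h = g sc" unfolding n by (rule C_crit)
    {
      obtain C where *: "0 < C" "C < g sc" "T C = pi / real k"
        using T_attains[OF _ hk] k by auto
      then interpret delaunay_oscillation m h C by unfold_locales auto
      show "\<exists>C\<in>{0<..<C_crit n h}. W n h C = 2 * pi / real k"
        using * W_eq by (intro bexI[of _ C]) (simp_all add: n crit[unfolded n])
    }
    {
      \<comment> \<open>The geometric conclusions hold for every solution \<open>C\<close>, not only
        for the one supplied by the intermediate value theorem.\<close>
      fix C assume C: "C \<in> {0<..<C_crit n h}" and W: "W n h C = 2 * pi / real k"
      interpret delaunay_oscillation m h C using C crit by unfold_locales auto
      have k0: "0 < k" using k by simp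
      note * = delaunay_hypersurface[OF dim k0 W[unfolded n], folded n]
      show "profile_curve (delaunay_curve n h C)" by (rule *(1))
      show "embedded_with_period
           (rot_hypersurface (delaunay_curve n h C) :: real \<times> (real^'m) \<Rightarrow> complex \<times> (real^'m))
           (real k * W n h C)" by (rule *(2))
      show "has_constant_mean_curvature
           (rot_hypersurface (delaunay_curve n h C) :: real \<times> (real^'m) \<Rightarrow> complex \<times> (real^'m)) h"
        by (rule *(3))
      show "least_period (\<lambda>t. snd (delaunay_curve n h C t)) (W n h C)" by (rule *(4))
    }
  qed
  then have "{20..} \<subseteq> ?S" by auto
  then show ?thesis using infinite_super infinite_Ici by blast
qed

end
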